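(* Fix an integer $n\ge 1$. The function $\rho_0(\gamma_1,\dots,\gamma_m)$ and the points $z_j$, $c_i$ are those of the slit-domain conformal map described in the context. (a) One has $$\mu_0\Bigl(\bigcup_{\{e^{i\theta}:\,e^{in\theta}=1\}}\mathrm{Loop}^1\bigl(\mathbb C^{\times}\setminus (0,1]e^{i\theta}\bigr)\setminus\mathrm{Loop}(\Delta^{*})\Bigr)=\sum_{m=1}^n(-1)^{m-1}\sum_{0\le\phi_1<\phi_2<\dots<\phi_m<2\pi}\ln\bigl(\rho_0(\gamma_1,\dots,\gamma_m)\bigr),$$ where in the inner sum $\exp(in\phi_j)=1$ for all $j$ and, with $\phi_{m+1}:=\phi_1+2\pi$, $\pi\gamma_i=\phi_{i+1}-\phi_i$ for $i=1,\dots,m$. (b) For any angles $0\le\phi_1<\dots<\phi_m<2\pi$ with associated $\gamma_j,z_j,c_j$, and for any $1\le i\le m$, $$\rho_0=\prod_{j=1}^m|z_j-c_i|^{\gamma_j}.$$ Hence also $$\rho_0=\Bigl(\prod_{j=1}^m a_j^{\gamma_j}\Bigr)^{1/m},\qquad\text{where } a_j=a_j(\gamma_1,\dots,\gamma_m)=\prod_{i=1}^m\Bigl|1-\frac{c_i}{z_j}\Bigr|.$$ When $m=2$, $a_1(\gamma_1,\gamma_2)=2\gamma_1$; and if all $\gamma_j=2/m$, then $a_j(2/m,\dots,2/m)=2$. (c) The sum in (a) can also be written as $$\sum_{m=1}^n(-1)^{m-1}\sum_{\gamma_1+\dots+\gamma_m=2}\bigl|\{\phi_1 : 0\le\phi_1<\pi\gamma_m\}\bigr|\,\ln\bigl(\rho_0(\gamma_1,\dots,\gamma_m)\bigr),$$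 where in the inner sum the $\gamma_j$ are positive multiples of $\frac2n$, and in the cardinality $\phi_1$ ranges over numbers with $e^{in\phi_1}=1$ (i.e. integer multiples of $2\pi/n$).
   Context: Slit domains. Let $\Delta$ be the open unit disk centered at $0$ and $\Delta^*=\{|z|>1\}\cup\{\infty\}$ the open unit disk centered at $\infty$. For angles $0\le\phi_1<\dots<\phi_m<2\pi$, put $\phi_{m+1}=\phi_1+2\pi$ and $\pi\gamma_j=\phi_{j+1}-\phi_j$, $j=1,\dots,m$, so $\gamma_j>0$ and $\sum_j\gamma_j=2$. The unique conformal isomorphism $$\phi_+:(\Delta,0)\to\Bigl(\mathbb C\setminus\bigcup_{j=1}^m\mathbb R_{\ge1}e^{i\phi_j},\,0\Bigr),\qquad \phi_+'(0)>0,$$ has (known Schwarz–Christoffel formula) the form $$\phi_+(z)=\rho_0\,z\prod_{j=1}^m\Bigl(1-\frac{z}{z_j}\Bigr)^{-\gamma_j},$$ with distinct $z_j\in S^1$ and $\rho_0=\phi_+'(0)>0$. Here $\rho_0$ depends only on $(\gamma_1,\dots,\gamma_m)$, and one writes $\rho_0=\rho_0(\gamma_1,\dots,\gamma_m)$. The points $c_1,\dots,c_m\in S^1$ are the points mapped by (the continuous extension of) $\phi_+$ to the slit tips: $\phi_+(c_j)=e^{i\phi_j}$; they are the zeros of $\phi_+'$. The labelling is such that $z_m,c_1,z_1,c_2,z_2,\dots,c_m,z_m$ are in cyclic (counterclockwise) order on the circle, so that $z_j$ lies between $c_j$ and $c_{j+1}$. Loops and measure. For a topological space $S$, $\mathrm{Loop}(S)$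 is the set of compact subsets of $S$ homeomorphic to $S^1$, with the topology induced by the Vietoris topology. For $S\subset\mathbb C^\times:=\mathbb C\setminus\{0\}$, $\mathrm{Loop}^1(S)$ is the set of loops in $\mathrm{Loop}(S)$ which surround $0$. A family $\{\mu_S\}$, with $\mu_S$ a positive Borel measure on $\mathrm{Loop}(S)$ for each Riemann surface $S$, satisfies conformal restriction if for every conformal embedding $S_1\to S_2$ the restriction of $\mu_{S_2}$ to $\mathrm{Loop}(S_1)$ equals $\mu_{S_1}$ (with $S_1$ identified with its image). Werner's theorem (known, may be assumed): there is a nontrivial family of locally finite measures satisfying conformal restriction, unique up to an overall positive constant. Let $\mu_0$ denote the restriction of this measure (for the plane) to $\mathrm{Loop}^1(\mathbb C^\times)$. The constant is fixed by Werner's formula (known, may be assumed): if $U,V$ are simply connected domains with $0\in U\subset V\subsetneq\mathbb C$, and $\phi:(U,0)\to(V,0)$ is a conformal isomorphism, then $$\mu_0\bigl(\mathrm{Loop}^1(V\setminus\{0\})\setminus\mathrm{Loop}(U)\bigr)=\log|\phi'(0)|.$$ *)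

theory Defs
  imports "HOL-Complex_Analysis.Complex_Analysis"
begin

section \<open>Loops and the Vietoris topology\<close>

definition loops :: "'a topology \<Rightarrow> 'a set set" where
  "loops X = {K. compactin X K \<and>
     subtopology X K homeomorphic_space top_of_set (sphere (0::complex) 1)}"

definition vietoris :: "'a topology \<Rightarrow> 'a set topology" where
  "vietoris X = topology_generated_by
     ({{K. compactin X K \<and> K \<subseteq> U} | U. openin X U} \<union>
      {{K. compactin X K \<and> K \<inter> U \<noteq> {}} | U. openin X U})"

definition loop_topology :: "'a topology \<Rightarrow> 'a set topology" where
  "loop_topology X = subtopology (vietoris X) (loops X)"

text \<open>Loops in a subset of the punctured plane that surround the origin.\<close>

definition loops1 :: "complex set \<Rightarrow> complex set set" where
  "loops1 S = {K \<in> loops (top_of_set S). 0 \<in> inside K}"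


section \<open>Riemann surfaces and conformal restriction\<close>

record 'a surface =
  surf_top :: "'a topology"
  atlas :: "('a set \<times> ('a \<Rightarrow> complex)) set"

definition riemann_surface :: "'a surface \<Rightarrow> bool" where
  "riemann_surface S \<longleftrightarrow>
     topspace (surf_top S) \<noteq> {} \<and> connected_space (surf_top S) \<and> Hausdorff_space (surf_top S) \<and>
     (\<Union>(U, \<phi>)\<in>atlas S. U) = topspace (surf_top S) \<and>
     (\<forall>(U, \<phi>)\<in>atlas S. openin (surf_top S) U \<and> open (\<phi> ` U) \<and>
        homeomorphic_map (subtopology (surf_top S) U) (top_of_set (\<phi> ` U)) \<phi>) \<and>
     (\<forall>(U, \<phi>)\<in>atlas S. \<forall>(V, \<psi>)\<in>atlas S.
        (\<lambda>w. \<psi> (inv_into U \<phi> w)) holomorphic_on \<phi> ` (U \<inter> V))"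

definition conformal_embedding :: "'a surface \<Rightarrow> 'b surface \<Rightarrow> ('a \<Rightarrow> 'b) \<Rightarrow> bool" where
  "conformal_embedding S T f \<longleftrightarrow>
     continuous_map (surf_top S) (surf_top T) f \<and> inj_on f (topspace (surf_top S)) \<and>
     (\<forall>(U, \<phi>)\<in>atlas S. \<forall>(V, \<psi>)\<in>atlas T.
        (\<lambda>w. \<psi> (f (inv_into U \<phi> w))) holomorphic_on \<phi> ` {x \<in> U. f x \<in> V})"

definition plane :: "complex surface" where
  "plane = \<lparr>surf_top = euclidean, atlas = {(UNIV, \<lambda>z. z)}\<rparr>"

text \<open>
  A family indexed by all Riemann surfaces is indexed here by those whose carrier is a subset of the
  type \<^typ>\<open>complex\<close>, with an arbitrary topology and atlas unrelated to the usual ones. Since a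
  connected Riemann surface is second countable, it has at most continuum many points, so every
  Riemann surface is isomorphic to one of these.
\<close>

type_synonym loop_measure_family = "complex surface \<Rightarrow> complex set measure"

definition borel_family :: "loop_measure_family \<Rightarrow> bool" where
  "borel_family \<mu> \<longleftrightarrow> (\<forall>S. riemann_surface S \<longrightarrow>
     sets (\<mu> S) = sets (sigma (loops (surf_top S)) {V. openin (loop_topology (surf_top S)) V}))"

definition conformal_restriction :: "loop_measure_family \<Rightarrow> bool" where
  "conformal_restriction \<mu> \<longleftrightarrow> (\<forall>S T f.
     riemann_surface S \<and> riemann_surface T \<and> conformal_embedding S T f \<longrightarrow>
     (\<forall>A\<in>sets (\<mu> S). emeasure (\<mu> T) ((\<lambda>K. f ` K) ` A) = emeasure (\<mu> S) A))"

definition locally_finite_family :: "loop_measure_family \<Rightarrow> bool" where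
  "locally_finite_family \<mu> \<longleftrightarrow> (\<forall>S. riemann_surface S \<longrightarrow> (\<forall>K\<in>loops (surf_top S).
     \<exists>V. openin (loop_topology (surf_top S)) V \<and> K \<in> V \<and> emeasure (\<mu> S) V < \<infinity>))"

definition nontrivial_family :: "loop_measure_family \<Rightarrow> bool" where
  "nontrivial_family \<mu> \<longleftrightarrow> (\<exists>S. riemann_surface S \<and> emeasure (\<mu> S) (loops (surf_top S)) \<noteq> 0)"

definition mu0 :: "loop_measure_family \<Rightarrow> complex set measure" where
  "mu0 \<mu> = restrict_space (\<mu> plane) (loops1 (- {0}))"

definition conformal_iso :: "(complex \<Rightarrow> complex) \<Rightarrow> complex set \<Rightarrow> complex set \<Rightarrow> bool" where
  "conformal_iso f U V \<longleftrightarrow> f holomorphic_on U \<and> bij_betw f U V"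

text \<open>
  The equation is stated in the extended reals, because the embedding of the reals into the
  nonnegative extended reals truncates negative numbers to 0.
\<close>

definition werner_formula :: "complex set measure \<Rightarrow> bool" where
  "werner_formula M \<longleftrightarrow> (\<forall>U V \<phi>.
     open U \<and> simply_connected U \<and> open V \<and> simply_connected V \<and>
     0 \<in> U \<and> U \<subseteq> V \<and> V \<noteq> UNIV \<and> conformal_iso \<phi> U V \<and> \<phi> 0 = 0 \<longrightarrow>
     enn2ereal (emeasure M (loops1 (V - {0}) - loops (top_of_set U))) =
       ereal (ln (cmod (deriv \<phi> 0))))"

definition werner_family :: "loop_measure_family \<Rightarrow> bool" where
  "werner_family \<mu> \<longleftrightarrow> borel_family \<mu> \<and> conformal_restriction \<mu> \<and> locally_finite_family \<mu> \<and>
     nontrivial_family \<mu> \<and> werner_formula (mu0 \<mu>)"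


section \<open>Slit domains\<close>

text \<open>Tuples indexed by 1, ..., m are lists of length m; the entry with index j is \<open>xs ! (j - 1)\<close>.\<close>

definition slit_angles :: "real list \<Rightarrow> bool" where
  "slit_angles \<phi> \<longleftrightarrow> \<phi> \<noteq> [] \<and> sorted_wrt (<) \<phi> \<and> set \<phi> \<subseteq> {0..<2 * pi}"

definition gammas :: "real list \<Rightarrow> real list" where
  "gammas \<phi> = map (\<lambda>j. ((\<phi> @ [hd \<phi> + 2 * pi]) ! Suc j - \<phi> ! j) / pi) [0..<length \<phi>]"

definition slit_domain :: "real list \<Rightarrow> complex set" where
  "slit_domain \<phi> = - (\<Union>\<alpha>\<in>set \<phi>. {of_real t * cis \<alpha> | t. t \<ge> 1})"

definition slit_map :: "real list \<Rightarrow> (complex \<Rightarrow> complex) \<Rightarrow> bool" where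
  "slit_map \<phi> f \<longleftrightarrow> conformal_iso f (ball 0 1) (slit_domain \<phi>) \<and> f 0 = 0 \<and>
     deriv f 0 \<in> \<real> \<and> Re (deriv f 0) > 0"

definition rho0 :: "real list \<Rightarrow> real" where
  "rho0 \<gamma> = (THE r. \<exists>\<phi> f. slit_angles \<phi> \<and> gammas \<phi> = \<gamma> \<and> slit_map \<phi> f \<and> deriv f 0 = of_real r)"

text \<open>
  \<open>z\<close> and \<open>c\<close> are the prevertices of infinity and of the slit tips. For \<open>w\<close> in the unit disk
  \<open>1 - w / z ! j\<close> lies in the right half plane, so the principal branch of the power is the
  holomorphic one with value 1 at 0. The numbers \<open>s\<close> and \<open>t\<close> are arguments of the points of \<open>c\<close> and
  \<open>z\<close>; they express the counterclockwise order c_1, z_1, c_2, z_2, ..., c_m, z_m.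
\<close>

definition slit_data ::
  "real list \<Rightarrow> (complex \<Rightarrow> complex) \<Rightarrow> complex list \<Rightarrow> complex list \<Rightarrow> bool" where
  "slit_data \<phi> f z c \<longleftrightarrow>
     slit_angles \<phi> \<and> slit_map \<phi> f \<and> length z = length \<phi> \<and> length c = length \<phi> \<and>
     distinct z \<and> set z \<subseteq> sphere 0 1 \<and> set c \<subseteq> sphere 0 1 \<and>
     (\<forall>w\<in>ball 0 1. f w =
        deriv f 0 * w * (\<Prod>j<length \<phi>. (1 - w / z ! j) powr (- of_real (gammas \<phi> ! j)))) \<and>
     (\<forall>j<length \<phi>. (f \<longlongrightarrow> cis (\<phi> ! j)) (at (c ! j) within ball 0 1)) \<and>
     (\<exists>s t :: nat \<Rightarrow> real.
        (\<forall>j<length \<phi>. c ! j = cis (s j) \<and> z ! j = cis (t j) \<and> s j < t j) \<and>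
        (\<forall>j. Suc j < length \<phi> \<longrightarrow> t j < s (Suc j)) \<and>
        t (length \<phi> - 1) < s 0 + 2 * pi)"

text \<open>\<open>slit_coeff \<gamma> j\<close> is a_{j+1}(gamma_1, ..., gamma_m).\<close>

definition slit_coeff :: "real list \<Rightarrow> nat \<Rightarrow> real" where
  "slit_coeff \<gamma> j = (THE a. \<exists>\<phi> f z c. slit_data \<phi> f z c \<and> gammas \<phi> = \<gamma> \<and>
     a = (\<Prod>i<length \<phi>. cmod (1 - c ! i / z ! j)))"

definition root_angles :: "nat \<Rightarrow> nat \<Rightarrow> real list set" where
  "root_angles n m = {\<phi>. length \<phi> = m \<and> slit_angles \<phi> \<and> (\<forall>\<alpha>\<in>set \<phi>. cis (real n * \<alpha>) = 1)}"

definition root_gammas :: "nat \<Rightarrow> nat \<Rightarrow> real list set" where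
  "root_gammas n m = {\<gamma>. length \<gamma> = m \<and> sum_list \<gamma> = 2 \<and>
     (\<forall>g\<in>set \<gamma>. \<exists>k::nat. k \<ge> 1 \<and> g = real k * (2 / real n))}"

end

theory Submission
  imports Defs
begin

text \<open>
  Part (a). The inversion \<open>z \<mapsto> 1/z\<close> of the punctured plane preserves the loop measure by conformal
  restriction, and it turns the sets of loops in question into loops in a plane slit along rays to
  infinity that are not contained in the unit disk. Intersections of such sets belong to several
  slits at once, Werner's formula evaluates them as \<open>ln \<rho>\<^sub>0\<close>, and inclusion-exclusion does the rest.

  Part (b). Since the slit domain contains the unit disk, the boundary values of the slit map have
  modulus at least 1, and a tip is a point of the circle where this minimum is attained. Hence the
  tips are zeros of the logarithmic derivative, that is of a polynomial of degree \<open>m\<close> built from the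
  \<open>z\<^sub>j\<close> and \<open>\<gamma>\<^sub>j\<close>, so this polynomial is \<open>\<Prod>\<^sub>i (1 - w/c\<^sub>i)\<close>. Evaluating it at \<open>z\<^sub>j\<close> gives
  \<open>a\<^sub>j = \<gamma>\<^sub>j \<Prod>\<^sub>k\<^sub>\<noteq>\<^sub>j |1 - z\<^sub>j/z\<^sub>k|\<close>, from which the two special cases follow by symmetry of the \<open>z\<^sub>j\<close>.

  Part (c). The angles are determined by the gaps \<open>\<gamma>\<close> and the first angle, which ranges over
  \<open>0 \<le> \<phi>\<^sub>1 < \<pi> \<gamma>\<^sub>m\<close>.
\<close>

section \<open>Loops and inversion\<close>

text \<open>Conformal restriction speaks about embeddings of surfaces, and inversion is not a
  self-map of the plane. It is therefore applied twice to the punctured plane, whose identity and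
  inversion are two embeddings into the plane; this forces all loop sets involved to be shown Borel
  in the loop space of the punctured plane. \<open>rho0\<close> and \<open>slit_coeff\<close> are
  definite descriptions that see only the gaps, so each statement about them rests on a uniqueness
  result: Schwarz's lemma fixes the map of a given slit domain, lists with equal gaps differ by a
  rotation, and for \<open>slit_coeff\<close> even the labelled lists \<open>z\<close> and
  \<open>c\<close> have to be recovered from the map. \<open>slit_data\<close> records limits of
  \<open>f\<close> at the tips and nothing about its derivative there. The extremal argument gets by
  without derivatives of \<open>f\<close> on the boundary: only the limit of its modulus is used,
  and the function that is differentiated is an explicit product of distances along the
  circle.\<close>

lemma loops_top_of_set: "loops (top_of_set S) = {K \<in> loops euclidean. K \<subseteq> S}"
proof -
  have "subtopology (top_of_set S) K = top_of_set K" if "K \<subseteq> S" for K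
    using that by (simp add: subtopology_subtopology inf.absorb2)
  then show ?thesis
    by (auto simp: loops_def compactin_subtopology)
qed

lemma mem_loops1_iff: "K \<in> loops1 S \<longleftrightarrow> K \<in> loops euclidean \<and> K \<subseteq> S \<and> 0 \<in> inside K"
  by (auto simp: loops1_def loops_top_of_set)

lemma loops_imp_compact: "K \<in> loops (euclidean :: 'a::topological_space topology) \<Longrightarrow> compact K"
  by (simp add: loops_def)

text \<open>By Borsuk, the origin lies in a bounded component of the complement iff the radial
  projection of \<open>K\<close> to the circle is essential, that is, has no continuous argument.
  Adding \<open>ln (norm x)\<close> turns an argument into a logarithm, a form of the condition that
  can be transported along inversion.\<close>

lemma zero_inside_iff_no_log:
  fixes K :: "complex set"
  assumes "compact K" "0 \<notin> K"
  shows "0 \<in> inside K \<longleftrightarrow> \<not> (\<exists>g. continuous_on K g \<and> (\<forall>x\<in>K. x = exp (g x)))"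
proof -
  have "0 \<in> inside K \<longleftrightarrow>
      \<not> (\<exists>c. homotopic_with_canon (\<lambda>x. True) K (sphere 0 1) (\<lambda>x. inverse (norm (x - 0)) *\<^sub>R (x - 0)) (\<lambda>x. c))"
    using Borsuk_map_essential_bounded_component[OF assms] assms(2) by (simp add: inside_def)
  also have "\<dots> \<longleftrightarrow> \<not> (\<exists>g. continuous_on K g \<and>
      (\<forall>x\<in>K. inverse (norm x) *\<^sub>R x = exp (\<i> * of_real (g x))))"
    by (simp add: inessential_eq_continuous_logarithm_circle)
  also have "(\<exists>g. continuous_on K g \<and> (\<forall>x\<in>K. inverse (norm x) *\<^sub>R x = exp (\<i> * of_real (g x))))
      \<longleftrightarrow> (\<exists>g. continuous_on K g \<and> (\<forall>x\<in>K. x = exp (g x)))" (is "?L \<longleftrightarrow> ?R")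
  proof
    assume ?L
    then obtain g where g: "continuous_on K g"
      "\<And>x. x \<in> K \<Longrightarrow> inverse (norm x) *\<^sub>R x = exp (\<i> * of_real (g x))" by blast
    have "x = exp (of_real (ln (norm x)) + \<i> * of_real (g x))" if "x \<in> K" for x
    proof -
      have "x \<noteq> 0" using that assms(2) by auto
      then have "x = norm x *\<^sub>R (inverse (norm x) *\<^sub>R x)" by simp
      also have "\<dots> = of_real (norm x) * exp (\<i> * of_real (g x))"
        using g(2)[OF that] by (simp add: scaleR_conv_of_real)
      also have "of_real (norm x) = exp (of_real (ln (norm x)) :: complex)"
        using \<open>x \<noteq> 0\<close> by (simp add: exp_of_real)
      finally show ?thesis by (simp add: exp_add)
    qed
    moreover have "continuous_on K (\<lambda>x. of_real (ln (norm x)) + \<i> * of_real (g x) :: complex)"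
      using g(1) assms(2) by (intro continuous_intros) auto
    ultimately show ?R by blast
  next
    assume ?R
    then obtain g where g: "continuous_on K g" "\<And>x. x \<in> K \<Longrightarrow> x = exp (g x)" by blast
    have "inverse (norm x) *\<^sub>R x = exp (\<i> * of_real (Im (g x)))" if "x \<in> K" for x
    proof -
      have "inverse (norm (exp (g x))) *\<^sub>R exp (g x) = exp (\<i> * of_real (Im (g x)))"
        by (simp add: exp_eq_polar[of "g x"] norm_mult scaleR_conv_of_real exp_minus cis_conv_exp[symmetric])
      then show ?thesis using g(2)[OF that] by simp
    qed
    moreover have "continuous_on K (\<lambda>x. Im (g x))"
      using g(1) by (intro continuous_intros)
    ultimately show ?L by blast
  qed
  finally show ?thesis .
qed

lemma continuous_on_inverse_punctured: "0 \<notin> K \<Longrightarrow> continuous_on K (inverse :: complex \<Rightarrow> complex)"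
  by (intro continuous_intros) auto

text \<open>If \<open>g\<close> is a logarithm on the inverted set, then
  \<open>- g (inverse x)\<close> is one on \<open>K\<close>.\<close>

lemma zero_inside_inverse_image:
  assumes "compact K" "0 \<notin> K" "0 \<in> inside K"
  shows "0 \<in> inside ((inverse :: complex \<Rightarrow> complex) ` K)"
proof -
  have "compact (inverse ` K)" "0 \<notin> inverse ` K"
    using assms by (auto intro!: compact_continuous_image continuous_on_inverse_punctured)
  moreover have "\<exists>g. continuous_on K g \<and> (\<forall>x\<in>K. x = exp (g x))"
    if g: "continuous_on (inverse ` K) g" "\<forall>x\<in>inverse ` K. x = exp (g x)" for g
  proof (intro exI conjI)
    show "continuous_on K (\<lambda>x. - g (inverse x))"
      using continuous_on_compose2[OF g(1) continuous_on_inverse_punctured[OF assms(2)]]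
      by (auto intro!: continuous_intros)
    show "\<forall>x\<in>K. x = exp (- g (inverse x))"
    proof
      fix x assume "x \<in> K"
      with g(2) have "inverse x = exp (g (inverse x))" by blast
      then show "x = exp (- g (inverse x))" by (metis exp_minus inverse_inverse_eq)
    qed
  qed
  ultimately show ?thesis
    using assms by (metis zero_inside_iff_no_log)
qed

lemma inverse_image_loops:
  assumes "K \<in> loops euclidean" "0 \<notin> K"
  shows "(inverse :: complex \<Rightarrow> complex) ` K \<in> loops euclidean"
proof -
  have "compact (inverse ` K)"
    using assms loops_imp_compact
    by (intro compact_continuous_image continuous_on_inverse_punctured)
  moreover have "homeomorphic_maps (top_of_set (inverse ` K)) (top_of_set K) inverse inverse"
    using assms(2) by (auto simp: homeomorphic_maps_def intro!: continuous_on_inverse_punctured)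
  then have "top_of_set (inverse ` K) homeomorphic_space top_of_set K"
    unfolding homeomorphic_space_def by blast
  ultimately show ?thesis
    using assms(1) unfolding loops_def by (auto intro: homeomorphic_space_trans)
qed

lemma inverse_image_mem_loops1:
  assumes "K \<in> loops1 (- {0})"
  shows "(inverse :: complex \<Rightarrow> complex) ` K \<in> loops1 (- {0})"
  using assms inverse_image_loops[of K] zero_inside_inverse_image[of K]
  by (auto simp: mem_loops1_iff loops_imp_compact)

section \<open>Borel sets of loops\<close>

definition borel_loops :: "complex set \<Rightarrow> complex set set set" where
  "borel_loops T = sigma_sets (loops (top_of_set T)) {V. openin (loop_topology (top_of_set T)) V}"

lemma openin_loop_topology_loops:
  assumes "open W" "W \<subseteq> T"
  shows "openin (loop_topology (top_of_set T)) (loops (top_of_set W))"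
proof -
  have "openin (top_of_set T) W"
    using assms by (metis open_subset)
  then have "openin (vietoris (top_of_set T)) {K. compactin (top_of_set T) K \<and> K \<subseteq> W}"
    unfolding vietoris_def by (intro topology_generated_by_Basis) blast
  moreover have "loops (top_of_set W) =
      {K. compactin (top_of_set T) K \<and> K \<subseteq> W} \<inter> loops (top_of_set T)"
    using assms(2) by (auto simp: loops_top_of_set compactin_subtopology loops_imp_compact)
  ultimately show ?thesis
    unfolding loop_topology_def openin_subtopology by blast
qed

lemma sigma_algebra_borel_loops: "sigma_algebra (loops (top_of_set T)) (borel_loops T)"
proof -
  have "{V. openin (loop_topology (top_of_set T)) V} \<subseteq> Pow (loops (top_of_set T))"
    by (auto simp: loop_topology_def openin_subtopology)
  then show ?thesis
    unfolding borel_loops_def by (rule sigma_algebra_sigma_sets)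
qed

lemma loops_in_borel_loops:
  assumes "open W" "W \<subseteq> T"
  shows "loops (top_of_set W) \<in> borel_loops T"
  unfolding borel_loops_def using openin_loop_topology_loops[OF assms] by (simp add: sigma_sets.Basic)

text \<open>A path from the origin to a far point, joined to the complement of a large ball, is a
  suitable \<open>C\<close>. Closedness of \<open>C\<close> matters: \<open>W - C\<close> stays
  open, so the loops that avoid \<open>C\<close> form an open set.\<close>

lemma zero_outside_iff:
  assumes K: "compact K" and "0 \<notin> (K :: complex set)"
  shows "0 \<in> outside K \<longleftrightarrow> (\<exists>C. closed C \<and> connected C \<and> \<not> bounded C \<and> 0 \<in> C \<and> C \<inter> K = {})"
proof
  assume 0: "0 \<in> outside K"
  obtain R where R: "K \<subseteq> ball 0 R" and "R > 0"
    using K compact_imp_bounded bounded_subset_ballD by blast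
  have conn: "path_connected (outside K)"
    using K by (intro connected_open_path_connected open_outside connected_outside)
      (auto simp: compact_imp_closed compact_imp_bounded)
  have sub: "- ball 0 R \<subseteq> outside K"
    using R by (intro outside_subset_convex[OF convex_ball])
  have "of_real R \<in> outside K"
    using sub \<open>R > 0\<close> by auto
  then obtain p where p: "path p" "path_image p \<subseteq> outside K" "pathstart p = 0" "pathfinish p = of_real R"
    using conn 0 unfolding path_connected_def by metis
  let ?C = "path_image p \<union> - ball 0 R"
  have "of_real R \<in> path_image p" "0 \<in> path_image p"
    using p pathfinish_in_path_image pathstart_in_path_image by metis+
  moreover have "connected (- ball (0::complex) R)"
    by (intro connected_complement_bounded_convex) auto
  moreover have "of_real R \<in> - ball (0::complex) R"
    using \<open>R > 0\<close> by auto
  ultimately have "connected ?C"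
    using p(1) by (intro connected_Un connected_path_image) auto
  moreover have "closed ?C" using p(1) by (intro closed_Un closed_path_image) auto
  moreover have "\<not> bounded ?C"
    by (metis bounded_Un bounded_ball cobounded_imp_unbounded)
  moreover have "?C \<inter> K = {}"
    using p(2) sub by (auto simp: outside_def)
  ultimately show "\<exists>C. closed C \<and> connected C \<and> \<not> bounded C \<and> 0 \<in> C \<and> C \<inter> K = {}"
    using \<open>0 \<in> path_image p\<close> by blast
next
  assume "\<exists>C. closed C \<and> connected C \<and> \<not> bounded C \<and> 0 \<in> C \<and> C \<inter> K = {}"
  then obtain C where C: "connected C" "\<not> bounded C" "0 \<in> C" "C \<inter> K = {}" by blast
  then have "C \<subseteq> connected_component_set (- K) 0"
    by (intro connected_component_maximal) auto
  then show "0 \<in> outside K"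
    using C(2) bounded_subset by (auto simp: outside)
qed

text \<open>
  The loops with the origin outside form an open set, whereas those with the origin inside do not:
  a loop that almost surrounds the origin can be Hausdorff close to one that does.
\<close>

lemma loops1_in_borel_loops:
  assumes W: "open W" "W \<subseteq> T" "0 \<notin> W"
  shows "loops1 W \<in> borel_loops T"
proof -
  define \<C> where "\<C> = {C :: complex set. closed C \<and> connected C \<and> \<not> bounded C \<and> 0 \<in> C}"
  have eq: "loops1 W = loops (top_of_set W) - (\<Union>C\<in>\<C>. loops (top_of_set (W - C)))"
  proof (intro set_eqI)
    fix K
    show "K \<in> loops1 W \<longleftrightarrow> K \<in> loops (top_of_set W) - (\<Union>C\<in>\<C>. loops (top_of_set (W - C)))"
    proof (cases "K \<in> loops euclidean \<and> K \<subseteq> W")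
      case True
      then have K: "compact K" "0 \<notin> K" using W by (auto simp: loops_imp_compact)
      have "0 \<in> inside K \<longleftrightarrow> 0 \<notin> outside K"
        using K(2) by (auto simp: inside_def outside_def)
      also have "\<dots> \<longleftrightarrow> \<not> (\<exists>C\<in>\<C>. K \<subseteq> W - C)"
        using True by (auto simp: zero_outside_iff[OF K] \<C>_def)
      finally show ?thesis
        using True by (auto simp: mem_loops1_iff loops_top_of_set)
    next
      case False
      then show ?thesis by (auto simp: mem_loops1_iff loops_top_of_set)
    qed
  qed
  interpret sigma_algebra "loops (top_of_set T)" "borel_loops T"
    by (rule sigma_algebra_borel_loops)
  have "openin (loop_topology (top_of_set T)) (\<Union>C\<in>\<C>. loops (top_of_set (W - C)))"
    using W by (intro openin_Union) (auto simp: \<C>_def intro!: openin_loop_topology_loops)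
  then have "(\<Union>C\<in>\<C>. loops (top_of_set (W - C))) \<in> borel_loops T"
    by (simp add: borel_loops_def sigma_sets.Basic)
  then show ?thesis
    unfolding eq using loops_in_borel_loops[OF W(1,2)] by (rule Diff[rotated])
qed

section \<open>Inversion as a symmetry of the loop measure\<close>

definition punctured_plane :: "complex surface" where
  "punctured_plane = \<lparr>surf_top = top_of_set (- {0}), atlas = {(- {0}, \<lambda>z. z)}\<rparr>"

lemma inv_into_ident: "x \<in> U \<Longrightarrow> inv_into U (\<lambda>z. z) x = x"
  using inv_into_f_f[of "\<lambda>z. z" U x] by (simp add: inj_on_def)

lemma homeomorphic_map_ident: "homeomorphic_map X X (\<lambda>x. x)"
  using homeomorphic_map_id[of X X] by (simp add: id_def)

lemma riemann_surface_plane: "riemann_surface plane"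
proof -
  have "(\<lambda>w. inv_into (UNIV :: complex set) (\<lambda>z. z) w) holomorphic_on UNIV"
    by (rule holomorphic_transform[where f = "\<lambda>z. z"]) (auto simp: inv_into_ident)
  moreover have "connected_space (euclidean :: complex topology)"
    using connected_UNIV by (metis connectedin_iff_connected connectedin_topspace topspace_euclidean)
  ultimately show ?thesis
    by (auto simp: riemann_surface_def plane_def homeomorphic_map_ident)
qed

lemma riemann_surface_punctured_plane: "riemann_surface punctured_plane"
proof -
  have "connected (- {0 :: complex})"
    by (rule connected_punctured_universe) simp
  moreover have "(- {0 :: complex}) \<noteq> {}"
    by (metis Compl_iff UNIV_I empty_iff insert_iff one_neq_zero)
  moreover have "(\<lambda>w. inv_into (- {0 :: complex}) (\<lambda>z. z) w) holomorphic_on - {0}"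
    by (rule holomorphic_transform[where f = "\<lambda>z. z"]) (auto simp: inv_into_ident)
  ultimately show ?thesis
    by (auto simp: riemann_surface_def punctured_plane_def connected_space_subtopology
      Hausdorff_space_euclidean Hausdorff_space_subtopology subtopology_subtopology openin_subtopology_self homeomorphic_map_ident)
qed

lemma conformal_embedding_punctured_plane:
  assumes "f holomorphic_on - {0}" "inj_on f (- {0})"
  shows "conformal_embedding punctured_plane plane f"
proof -
  have "(\<lambda>w. f (inv_into (- {0}) (\<lambda>z. z) w)) holomorphic_on - {0}"
    by (rule holomorphic_transform[OF assms(1)]) (auto simp: inv_into_ident)
  then show ?thesis
    using assms holomorphic_on_imp_continuous_on
    by (auto simp: conformal_embedding_def punctured_plane_def plane_def)
qed

context
  fixes \<mu> :: loop_measure_family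
  assumes \<mu>: "werner_family \<mu>"
begin

lemma sets_plane: "sets (\<mu> plane) = borel_loops UNIV"
proof -
  have "{V. openin (loop_topology (euclidean :: complex topology)) V} \<subseteq> Pow (loops euclidean)"
    by (auto simp: loop_topology_def openin_subtopology)
  then show ?thesis
    using \<mu> riemann_surface_plane
    by (auto simp: werner_family_def borel_family_def plane_def borel_loops_def)
qed

lemma sets_punctured_plane: "sets (\<mu> punctured_plane) = borel_loops (- {0})"
proof -
  have "{V. openin (loop_topology (top_of_set (- {0 :: complex}))) V} \<subseteq> Pow (loops (top_of_set (- {0})))"
    by (auto simp: loop_topology_def openin_subtopology)
  then show ?thesis
    using \<mu> riemann_surface_punctured_plane
    by (auto simp: werner_family_def borel_family_def punctured_plane_def borel_loops_def)
qed

text \<open>Both sides equal the measure of \<open>A\<close> on the loops of the punctured plane,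
  one through the embedding by inversion and the other through the inclusion.\<close>

lemma emeasure_plane_inverse_image:
  assumes "A \<in> borel_loops (- {0})"
  shows "emeasure (\<mu> plane) ((\<lambda>K. inverse ` K) ` A) = emeasure (\<mu> plane) A"
proof -
  have *: "emeasure (\<mu> plane) ((\<lambda>K. f ` K) ` A) = emeasure (\<mu> punctured_plane) A"
    if "f holomorphic_on - {0}" "inj_on f (- {0})" for f
    using \<mu> riemann_surface_plane riemann_surface_punctured_plane
      conformal_embedding_punctured_plane[OF that] assms
    unfolding werner_family_def conformal_restriction_def sets_punctured_plane[symmetric] by blast
  have "inverse holomorphic_on - {0 :: complex}"
    by (intro holomorphic_intros) auto
  with *[of inverse] *[of "\<lambda>z. z"] show ?thesis by (simp add: inj_on_def)
qed

lemma emeasure_mu0: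
  assumes "A \<subseteq> loops1 (- {0})"
  shows "emeasure (mu0 \<mu>) A = emeasure (\<mu> plane) A"
proof -
  have "loops1 (- {0}) \<in> sets (\<mu> plane)"
    unfolding sets_plane by (intro loops1_in_borel_loops) auto
  then show ?thesis
    unfolding mu0_def using assms by (intro emeasure_restrict_space) auto
qed

end

section \<open>Slit domains and their Riemann maps\<close>

text \<open>After rotation by \<open>cis (- \<alpha>)\<close> a slit is cut out by one equation and
  one weak inequality between continuous functions, which makes its closedness immediate.\<close>

lemma mem_slit_iff: "w \<in> {of_real t * cis \<alpha> | t. t \<ge> 1} \<longleftrightarrow> Im (w * cis (- \<alpha>)) = 0 \<and> Re (w * cis (- \<alpha>)) \<ge> 1"
proof
  assume "w \<in> {of_real t * cis \<alpha> | t. t \<ge> 1}"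
  then obtain t where "t \<ge> 1" "w = of_real t * cis \<alpha>" by blast
  moreover have "of_real t * cis \<alpha> * cis (- \<alpha>) = of_real t"
    by (simp add: mult.assoc cis_mult)
  ultimately show "Im (w * cis (- \<alpha>)) = 0 \<and> Re (w * cis (- \<alpha>)) \<ge> 1"
    by (metis Im_complex_of_real Re_complex_of_real)
next
  assume *: "Im (w * cis (- \<alpha>)) = 0 \<and> Re (w * cis (- \<alpha>)) \<ge> 1"
  have "w = w * cis (- \<alpha>) * cis \<alpha>" by (simp add: mult.assoc cis_mult)
  also have "w * cis (- \<alpha>) = of_real (Re (w * cis (- \<alpha>)))"
    using * by (simp add: complex_eq_iff)
  finally show "w \<in> {of_real t * cis \<alpha> | t. t \<ge> 1}" using * by blast
qed

lemma slit_domain_alt: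
  "slit_domain \<phi> = {w. \<forall>\<alpha>\<in>set \<phi>. \<not> (Im (w * cis (- \<alpha>)) = 0 \<and> Re (w * cis (- \<alpha>)) \<ge> 1)}"
  unfolding slit_domain_def using mem_slit_iff by blast

lemma open_slit_domain: "open (slit_domain \<phi>)"
proof -
  have "closed {of_real t * cis \<alpha> | t. t \<ge> 1}" for \<alpha>
  proof -
    have "closed ({w. Im (w * cis (- \<alpha>)) = 0} \<inter> {w. Re (w * cis (- \<alpha>)) \<ge> 1})"
      by (intro closed_Int closed_Collect_eq closed_Collect_le continuous_intros)
    also have "\<dots> = {of_real t * cis \<alpha> | t. t \<ge> 1}"
      using mem_slit_iff by blast
    finally show ?thesis .
  qed
  then show ?thesis
    unfolding slit_domain_def by (intro open_Compl closed_UN) auto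
qed

lemma ball_subset_slit_domain: "ball 0 1 \<subseteq> slit_domain \<phi>"
  by (auto simp: slit_domain_def norm_mult)

text \<open>Slits are stable under multiplication by factors at least 1, so shrinking a point
  towards 0 cannot enter one. Star-shapedness supplies the simple connectivity that the Riemann
  mapping theorem and Werner's formula require.\<close>

lemma starlike_slit_domain: "starlike (slit_domain \<phi>)"
proof -
  have "closed_segment 0 x \<subseteq> slit_domain \<phi>" if "x \<in> slit_domain \<phi>" for x
  proof
    fix y assume "y \<in> closed_segment 0 x"
    then obtain u where u: "0 \<le> u" "u \<le> 1" "y = u *\<^sub>R x"
      by (auto simp: in_segment)
    show "y \<in> slit_domain \<phi>"
    proof (rule ccontr)
      assume "y \<notin> slit_domain \<phi>"
      then obtain \<alpha> where \<alpha>: "\<alpha> \<in> set \<phi>" "Im (y * cis (- \<alpha>)) = 0" "Re (y * cis (- \<alpha>)) \<ge> 1"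
        by (auto simp: slit_domain_alt)
      have y: "y * cis (- \<alpha>) = u *\<^sub>R (x * cis (- \<alpha>))" by (simp add: u)
      have "u \<noteq> 0" using \<alpha>(3) unfolding y by auto
      then have "Im (x * cis (- \<alpha>)) = 0" using \<alpha>(2) unfolding y by simp
      moreover have "1 \<le> u * Re (x * cis (- \<alpha>))" using \<alpha>(3) unfolding y by simp
      then have "Re (x * cis (- \<alpha>)) \<ge> 1"
        using u(1,2) by (smt (verit) mult_left_le_one_le mult_nonneg_nonpos)
      ultimately show False using that \<alpha>(1) by (auto simp: slit_domain_alt)
    qed
  qed
  moreover have "0 \<in> slit_domain \<phi>"
    using ball_subset_slit_domain by fastforce
  ultimately show ?thesis unfolding starlike_def by blast
qed

lemma slit_domain_neq_UNIV:
  assumes "\<phi> \<noteq> []"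
  shows "slit_domain \<phi> \<noteq> UNIV"
proof -
  have "cis (hd \<phi>) \<notin> slit_domain \<phi>"
    using assms by (auto simp: slit_domain_alt cis_mult intro!: bexI[of _ "hd \<phi>"])
  then show ?thesis by auto
qed

lemma ex_slit_map:
  assumes "\<phi> \<noteq> []"
  shows "\<exists>f. slit_map \<phi> f"
proof -
  let ?D = "slit_domain \<phi>"
  have 0: "0 \<in> ?D" using ball_subset_slit_domain by fastforce
  have "open ?D \<and> simply_connected ?D"
    by (simp add: open_slit_domain starlike_imp_simply_connected starlike_slit_domain)
  then have "\<exists>f g. f holomorphic_on ?D \<and> g holomorphic_on ball 0 1 \<and>
           (\<forall>z\<in>?D. f z \<in> ball 0 1 \<and> g (f z) = z) \<and> (\<forall>z\<in>ball 0 1. g z \<in> ?D \<and> f (g z) = z)"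
    using slit_domain_neq_UNIV[OF assms] 0 Riemann_mapping_theorem[of ?D] by blast
  then obtain f g where f: "f holomorphic_on ?D" and g: "g holomorphic_on ball 0 1"
    and fg: "\<And>z. z \<in> ?D \<Longrightarrow> f z \<in> ball 0 1 \<and> g (f z) = z"
      "\<And>z. z \<in> ball 0 1 \<Longrightarrow> g z \<in> ?D \<and> f (g z) = z"
    by blast
  \<comment> \<open>A disk automorphism \<open>p\<close> with inverse \<open>q\<close> that moves
    the image of the origin to the centre.\<close>
  obtain p q where p: "p (f 0) = 0" "p holomorphic_on ball 0 1" "p ` ball 0 1 \<subseteq> ball 0 1"
    and q: "q holomorphic_on ball 0 1" "q ` ball 0 1 \<subseteq> ball 0 1"
    and pq: "\<And>z. z \<in> ball 0 1 \<Longrightarrow> p (q z) = z" "\<And>z. z \<in> ball 0 1 \<Longrightarrow> q (p z) = z"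
    using ball_biholomorphism_exists[of "f 0"] fg(1)[OF 0] by blast
  define h where "h = g \<circ> q"
  have h: "h holomorphic_on ball 0 1"
    unfolding h_def using q g holomorphic_on_compose holomorphic_on_subset by blast
  have bij_h: "bij_betw h (ball 0 1) ?D"
  proof (rule bij_betw_byWitness[where f' = "p \<circ> f"])
    have qb: "q w \<in> ball 0 1" if "w \<in> ball 0 1" for w using q(2) that by blast
    have pb: "p w \<in> ball 0 1" if "w \<in> ball 0 1" for w using p(3) that by blast
    show "\<forall>w\<in>ball 0 1. (p \<circ> f) (h w) = w"
      unfolding h_def o_def using fg(2)[OF qb] pq(1) by metis
    show "\<forall>w\<in>?D. h ((p \<circ> f) w) = w"
      unfolding h_def o_def using fg(1) pq(2) by metis
    show "h ` ball 0 1 \<subseteq> ?D"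
      unfolding h_def o_def using fg(2)[OF qb] by blast
    show "(p \<circ> f) ` ?D \<subseteq> ball 0 1"
      unfolding o_def using fg(1) pb by blast
  qed
  have h0: "h 0 = 0"
    using p(1) pq(2)[of "f 0"] fg(1)[OF 0] by (metis comp_apply h_def)
  have d: "deriv h 0 \<noteq> 0"
    using h bij_h by (intro holomorphic_injective_imp_regular[of h "ball 0 1"]) (auto simp: bij_betw_def)
  \<comment> \<open>The unit number for which \<open>a * deriv h 0\<close> equals
    \<open>norm (deriv h 0)\<close>, so that precomposing with this rotation makes the derivative
    positive.\<close>
  define a where "a = cnj (sgn (deriv h 0))"
  have a: "norm a = 1" using d by (simp add: a_def norm_sgn)
  define k where "k = (\<lambda>w. h (a * w))"
  have im: "(\<lambda>w. a * w) ` ball 0 1 = ball 0 1"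
  proof -
    have "w = a * (w / a)" for w
      using a by auto
    moreover have "w / a \<in> ball 0 1" if "w \<in> ball 0 1" for w
      using a that by (simp add: norm_divide)
    ultimately have "ball 0 1 \<subseteq> (\<lambda>w. a * w) ` ball 0 1" by blast
    moreover have "(\<lambda>w. a * w) ` ball 0 1 \<subseteq> ball 0 1"
      using a by (auto simp: norm_mult)
    ultimately show ?thesis by blast
  qed
  have "k holomorphic_on ball 0 1"
    using holomorphic_on_compose[of "\<lambda>w. a * w" "ball 0 1" h] h unfolding k_def
    by (auto simp: im o_def intro!: holomorphic_intros)
  moreover have "bij_betw k (ball 0 1) ?D"
  proof -
    have "bij_betw (\<lambda>w. a * w) (ball 0 1) (ball 0 1)"
      using a im by (auto simp: bij_betw_def inj_on_def)
    from bij_betw_trans[OF this bij_h] show ?thesis by (simp add: k_def o_def)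
  qed
  moreover have "deriv k 0 = a * deriv h 0"
  proof (rule DERIV_imp_deriv)
    have "(h has_field_derivative deriv h 0) (at (a * 0))"
      using h by (auto intro!: holomorphic_derivI[of _ "ball 0 1"])
    from DERIV_chain2[where g = "\<lambda>w. a * w" and Db = a, OF this DERIV_cmult_Id]
    show "(k has_field_derivative a * deriv h 0) (at 0)"
      unfolding k_def by (simp add: mult.commute)
  qed
  moreover have "a * deriv h 0 = of_real (norm (deriv h 0))"
  proof -
    have "a * deriv h 0 = cnj (deriv h 0) * deriv h 0 / of_real (norm (deriv h 0))"
      by (simp add: a_def sgn_div_norm scaleR_conv_of_real divide_inverse)
    also have "cnj (deriv h 0) * deriv h 0 = of_real (norm (deriv h 0)) * of_real (norm (deriv h 0))"
      using complex_norm_square[of "deriv h 0"] by (simp add: power2_eq_square mult.commute)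
    finally show ?thesis using d by simp
  qed
  ultimately have "slit_map \<phi> k"
    using d h0 by (auto simp: slit_map_def conformal_iso_def k_def)
  then show ?thesis by blast
qed

text \<open>Schwarz's lemma for the composition of \<open>g\<close> with the inverse of
  \<open>f\<close>, a self-map of the disk that fixes 0 and has derivative
  \<open>deriv g 0 / deriv f 0\<close> there. The hypotheses are symmetric in \<open>f\<close> and
  \<open>g\<close>, so two applications give equal moduli and hence the rotation case.\<close>

lemma deriv_conformal_iso_le:
  assumes f: "conformal_iso f (ball 0 1) D" "f 0 = 0"
    and g: "conformal_iso g (ball 0 1) D" "g 0 = 0"
  shows "norm (deriv g 0) \<le> norm (deriv f 0)"
    and "norm (deriv g 0) = norm (deriv f 0) \<Longrightarrow>
      \<exists>\<alpha>. norm \<alpha> = 1 \<and> deriv g 0 = \<alpha> * deriv f 0 \<and> (\<forall>w\<in>ball 0 1. g w = f (\<alpha> * w))"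
proof -
  obtain k where k: "k holomorphic_on f ` ball 0 1"
      "\<And>z. z \<in> ball 0 1 \<Longrightarrow> deriv f z * deriv k (f z) = 1"
      "\<And>z. z \<in> ball 0 1 \<Longrightarrow> k (f z) = z"
    using f holomorphic_has_inverse[of f "ball 0 1"] by (auto simp: conformal_iso_def bij_betw_def)
  have im: "f ` ball 0 1 = D" "g ` ball 0 1 = D" using f g by (auto simp: conformal_iso_def bij_betw_def)
  have fhol: "f holomorphic_on ball 0 1" "inj_on f (ball 0 1)" and ghol: "g holomorphic_on ball 0 1"
    using f g by (auto simp: conformal_iso_def bij_betw_def)
  have "open D" using open_mapping_thm3[OF fhol(1) _ fhol(2)] im by simp
  define h where "h = k \<circ> g"
  have h: "h holomorphic_on ball 0 1"
    unfolding h_def using k(1) ghol im by (auto intro: holomorphic_on_compose)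
  have h0: "h 0 = 0" using k(3)[of 0] f g by (simp add: h_def)
  have fh: "f (h w) = g w" "norm (h w) < 1" if "norm w < 1" for w
  proof -
    have "g w \<in> f ` ball 0 1" using that im by auto
    then obtain v where "v \<in> ball 0 1" "g w = f v" by blast
    then show "f (h w) = g w" "norm (h w) < 1" using k(3) by (auto simp: h_def)
  qed
  have "f field_differentiable at 0" "g field_differentiable at 0"
    using fhol ghol holomorphic_on_imp_differentiable_at[of _ "ball 0 1" 0] by auto
  moreover have "k field_differentiable at (g 0)"
    using k(1) im \<open>open D\<close> f g
    by (intro holomorphic_on_imp_differentiable_at[of _ D]) (auto simp: image_iff intro!: bexI[of _ 0])
  ultimately have dh: "deriv h 0 = deriv k 0 * deriv g 0"
    unfolding h_def using g by (simp add: deriv_chain)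
  have kf: "deriv f 0 * deriv k 0 = 1" using k(2)[of 0] f by simp
  then have df: "deriv f 0 \<noteq> 0" by auto
  have dh': "deriv h 0 = deriv g 0 / deriv f 0"
    using kf df by (simp add: dh field_simps)
  have "norm (deriv h 0) \<le> 1"
    by (rule Schwarz_Lemma(2)[OF h h0, of 0]) (use fh in auto)
  then show "norm (deriv g 0) \<le> norm (deriv f 0)"
    using df by (simp add: dh' norm_divide field_simps)
  assume "norm (deriv g 0) = norm (deriv f 0)"
  then have "norm (deriv h 0) = 1" using df by (simp add: dh' norm_divide)
  then obtain \<alpha> where \<alpha>: "\<And>z. norm z < 1 \<Longrightarrow> h z = \<alpha> * z" "norm \<alpha> = 1"
    using Schwarz_Lemma(3)[OF h h0, of 0] fh by auto
  have "(h has_field_derivative \<alpha>) (at 0)"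
    by (rule has_field_derivative_transform_within_open[of "\<lambda>z. \<alpha> * z" _ _ "ball 0 1"])
      (use \<alpha> in \<open>auto intro!: derivative_eq_intros\<close>)
  then have "deriv h 0 = \<alpha>" by (rule DERIV_imp_deriv)
  then have "deriv g 0 = \<alpha> * deriv f 0" using df by (simp add: dh' field_simps)
  moreover have "g w = f (\<alpha> * w)" if "w \<in> ball 0 1" for w
    using fh(1)[of w] \<alpha>(1)[of w] that by simp
  ultimately show "\<exists>\<alpha>. norm \<alpha> = 1 \<and> deriv g 0 = \<alpha> * deriv f 0 \<and> (\<forall>w\<in>ball 0 1. g w = f (\<alpha> * w))"
    using \<alpha>(2) by blast
qed

lemma slit_map_deriv: "slit_map \<phi> f \<Longrightarrow> deriv f 0 = of_real (norm (deriv f 0)) \<and> norm (deriv f 0) > 0"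
  unfolding slit_map_def by (metis Reals_cases Re_complex_of_real abs_of_pos norm_of_real)

lemma slit_map_unique:
  assumes "slit_map \<phi> f" "slit_map \<psi> g" "slit_domain \<phi> = slit_domain \<psi>"
  shows "deriv f 0 = deriv g 0" "w \<in> ball 0 1 \<Longrightarrow> f w = g w"
proof -
  have ci: "conformal_iso f (ball 0 1) (slit_domain \<phi>)" "f 0 = 0"
    "conformal_iso g (ball 0 1) (slit_domain \<phi>)" "g 0 = 0"
    using assms by (auto simp: slit_map_def)
  have eq: "norm (deriv g 0) = norm (deriv f 0)"
    using deriv_conformal_iso_le(1)[OF ci] deriv_conformal_iso_le(1)[OF ci(3,4,1,2)] by linarith
  then show eq': "deriv f 0 = deriv g 0"
    using slit_map_deriv assms by metis
  obtain \<alpha> where \<alpha>: "deriv g 0 = \<alpha> * deriv f 0" "\<forall>w\<in>ball 0 1. g w = f (\<alpha> * w)"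
    using deriv_conformal_iso_le(2)[OF ci eq] by blast
  have "\<alpha> = 1" using \<alpha>(1) eq' slit_map_deriv[OF assms(1)] by auto
  then show "f w = g w" if "w \<in> ball 0 1" using \<alpha>(2) that by simp
qed

text \<open>The hypothesis compares directions and not lists of angles. Hence it also covers
  \<open>\<psi> = \<phi>\<close> when the rotation merely permutes the slits, which is how the case
  of equal gaps is treated.\<close>

lemma slit_domain_rotate:
  assumes "cis ` set \<psi> = (\<lambda>x. cis (\<alpha> + x)) ` set \<phi>"
  shows "slit_domain \<psi> = (\<lambda>w. cis \<alpha> * w) ` slit_domain \<phi>"
proof -
  have *: "slit_domain \<phi> = - (\<Union>a\<in>cis ` set \<phi>. {of_real t * a | t. t \<ge> 1})" for \<phi>
    by (auto simp: slit_domain_def)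
  have "(\<lambda>w. cis \<alpha> * w) ` slit_domain \<phi>
      = - ((\<lambda>w. cis \<alpha> * w) ` (\<Union>a\<in>cis ` set \<phi>. {of_real t * a | t. t \<ge> 1}))"
    unfolding *
  proof (rule bij_image_Compl_eq)
    have "inj (\<lambda>w. cis \<alpha> * w)" by (simp add: inj_on_def)
    moreover have "w = cis \<alpha> * (cis (- \<alpha>) * w)" for w
      by (simp add: mult.assoc[symmetric] cis_mult)
    ultimately show "bij (\<lambda>w. cis \<alpha> * w)" by (metis bijI surjI)
  qed
  also have "(\<lambda>w. cis \<alpha> * w) ` (\<Union>a\<in>cis ` set \<phi>. {of_real t * a | t. t \<ge> 1})
      = (\<Union>a\<in>cis ` set \<psi>. {of_real t * a | t. t \<ge> 1})"
  proof -
    have "(\<lambda>w. cis \<alpha> * w) ` {of_real t * a | t. t \<ge> 1} = {of_real t * (cis \<alpha> * a) | t. t \<ge> 1}" for a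
      by (auto simp: image_iff mult.left_commute)
    then show ?thesis
      unfolding assms by (simp add: image_UN cis_mult[symmetric])
  qed
  finally show ?thesis unfolding * ..
qed

lemma slit_map_rotate:
  assumes f: "slit_map \<phi> f" and eq: "cis ` set \<psi> = (\<lambda>x. cis (\<alpha> + x)) ` set \<phi>"
  defines "g \<equiv> (\<lambda>w. cis \<alpha> * f (cis (- \<alpha>) * w))"
  shows "slit_map \<psi> g" "deriv g 0 = deriv f 0"
proof -
  have im: "bij_betw (\<lambda>w. cis (- \<alpha>) * w) (ball 0 1) (ball 0 1)"
    by (rule bij_betw_byWitness[where f' = "\<lambda>w. cis \<alpha> * w"])
      (auto simp: mult.assoc[symmetric] cis_mult norm_mult)
  have hol: "f holomorphic_on ball 0 1" and bij: "bij_betw f (ball 0 1) (slit_domain \<phi>)"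
    using f by (auto simp: slit_map_def conformal_iso_def)
  have "g holomorphic_on ball 0 1"
    using holomorphic_on_compose[of "\<lambda>w. cis (- \<alpha>) * w" "ball 0 1" f] hol im unfolding g_def
    by (auto simp: o_def bij_betw_def intro!: holomorphic_intros)
  moreover have "bij_betw g (ball 0 1) (slit_domain \<psi>)"
  proof -
    have "bij_betw (\<lambda>w. cis \<alpha> * w) (slit_domain \<phi>) (slit_domain \<psi>)"
      unfolding slit_domain_rotate[OF eq] by (auto simp: bij_betw_def inj_on_def)
    from bij_betw_trans[OF bij_betw_trans[OF im bij] this] show ?thesis by (simp add: g_def o_def)
  qed
  moreover show d: "deriv g 0 = deriv f 0"
  proof (rule DERIV_imp_deriv)
    have "(f has_field_derivative deriv f 0) (at (cis (- \<alpha>) * 0))"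
      using hol by (auto intro!: holomorphic_derivI[of _ "ball 0 1"])
    from DERIV_chain2[where g = "\<lambda>w. cis (- \<alpha>) * w" and Db = "cis (- \<alpha>)", OF this]
    have "((\<lambda>w. f (cis (- \<alpha>) * w)) has_field_derivative deriv f 0 * cis (- \<alpha>)) (at 0)"
      by (auto intro!: derivative_eq_intros)
    from DERIV_cmult[OF this, of "cis \<alpha>"] show "(g has_field_derivative deriv f 0) (at 0)"
      unfolding g_def by (simp add: mult.left_commute[of "cis \<alpha>"] cis_mult)
  qed
  ultimately show "slit_map \<psi> g"
    using f by (auto simp: slit_map_def conformal_iso_def g_def)
qed

section \<open>Gaps between the slit angles\<close>

lemma length_gammas [simp]: "length (gammas \<phi>) = length \<phi>"
  by (simp add: gammas_def)

lemma gammas_nth: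
  assumes "j < length \<phi>"
  shows "gammas \<phi> ! j = ((if Suc j < length \<phi> then \<phi> ! Suc j else \<phi> ! 0 + 2 * pi) - \<phi> ! j) / pi"
  using assms hd_conv_nth[of \<phi>] by (cases "\<phi> = []") (auto simp: gammas_def nth_append)

lemma gammas_pos:
  assumes "slit_angles \<phi>" "j < length \<phi>"
  shows "gammas \<phi> ! j > 0"
proof -
  have "\<phi> ! j < \<phi> ! Suc j" if "Suc j < length \<phi>"
    using assms that by (auto simp: slit_angles_def sorted_wrt_iff_nth_less)
  moreover have "\<phi> ! j < 2 * pi" "\<phi> ! 0 \<ge> 0"
    using assms by (auto simp: slit_angles_def subset_iff in_set_conv_nth)
  ultimately show ?thesis using assms by (auto simp: gammas_nth)
qed

lemma gammas_partial_sum: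
  assumes "k < length \<phi>"
  shows "(\<Sum>j<k. gammas \<phi> ! j) = (\<phi> ! k - \<phi> ! 0) / pi"
  using assms by (induction k) (auto simp: gammas_nth diff_divide_distrib add_divide_distrib)

lemma sum_gammas:
  assumes "\<phi> \<noteq> []"
  shows "(\<Sum>j<length \<phi>. gammas \<phi> ! j) = 2"
proof -
  obtain k where "length \<phi> = Suc k" using assms by (cases \<phi>) auto
  then show ?thesis
    using gammas_partial_sum[of k \<phi>] by (simp add: gammas_nth field_simps)
qed

lemma gammas_eq_imp_shift:
  assumes "\<phi> \<noteq> []" "gammas \<phi> = gammas \<psi>"
  shows "\<psi> = map (\<lambda>x. (\<psi> ! 0 - \<phi> ! 0) + x) \<phi>"
proof -
  have len: "length \<phi> = length \<psi>" using assms(2) by (metis length_gammas)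
  show ?thesis
  proof (rule nth_equalityI)
    fix k assume "k < length \<psi>"
    then show "\<psi> ! k = map (\<lambda>x. (\<psi> ! 0 - \<phi> ! 0) + x) \<phi> ! k"
      using gammas_partial_sum[of k \<phi>] gammas_partial_sum[of k \<psi>] assms len by simp
  qed (simp add: len)
qed

text \<open>The description in \<open>rho0\<close> is well defined because angle lists with the same
  gaps differ by a constant shift, and conjugating a slit map by the corresponding rotation keeps
  its derivative at 0.\<close>

lemma rho0_gammas:
  assumes "slit_angles \<phi>" "slit_map \<phi> f"
  shows "deriv f 0 = of_real (rho0 (gammas \<phi>))"
proof -
  have "rho0 (gammas \<phi>) = norm (deriv f 0)"
    unfolding rho0_def
  proof (rule the_equality)
    show "\<exists>\<psi> g. slit_angles \<psi> \<and> gammas \<psi> = gammas \<phi> \<and> slit_map \<psi> g \<and>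
        deriv g 0 = of_real (norm (deriv f 0))"
      using assms slit_map_deriv by blast
  next
    fix r assume "\<exists>\<psi> g. slit_angles \<psi> \<and> gammas \<psi> = gammas \<phi> \<and> slit_map \<psi> g \<and> deriv g 0 = of_real r"
    then obtain \<psi> g where g: "slit_angles \<psi>" "gammas \<psi> = gammas \<phi>" "slit_map \<psi> g" "deriv g 0 = of_real r"
      by blast
    have shift: "\<psi> = map (\<lambda>x. (\<psi> ! 0 - \<phi> ! 0) + x) \<phi>"
      using gammas_eq_imp_shift[of \<phi> \<psi>] assms(1) g(2) by (simp add: slit_angles_def)
    have "cis ` set \<psi> = (\<lambda>x. cis ((\<psi> ! 0 - \<phi> ! 0) + x)) ` set \<phi>"
      by (subst shift) (simp add: image_image)
    note rot = slit_map_rotate[OF assms(2) this]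
    from slit_map_unique(1)[OF rot(1) g(3)] rot(2) have "deriv f 0 = deriv g 0" by simp
    moreover have "r \<ge> 0" using g(3,4) by (simp add: slit_map_def)
    ultimately show "r = norm (deriv f 0)" using g(4) by simp
  qed
  then show ?thesis using slit_map_deriv[OF assms(2)] by simp
qed

section \<open>Prevertices of the tips\<close>

lemma cis_inj:
  assumes "cis x = cis y" "\<bar>x - y\<bar> < 2 * pi"
  shows "x = y"
proof -
  have "sin x = sin y \<and> cos x = cos y" using assms(1) by (simp add: cis.ctr)
  then obtain n :: int where n: "x = y + 2 * pi * n" using sin_cos_eq_iff[of x y] by blast
  then have "2 * pi * \<bar>real_of_int n\<bar> < 2 * pi * 1" using assms(2) by (simp add: abs_mult)
  then have "\<bar>real_of_int n\<bar> < 1" by (subst (asm) mult_less_cancel_left_pos) auto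
  then have "n = 0" by linarith
  then show ?thesis using n by simp
qed

lemma norm_powr_of_real: "w \<noteq> 0 \<Longrightarrow> norm (w powr of_real a) = norm w powr a" for w :: complex
  by (simp add: powr_def)

text \<open>The Moebius map taking \<open>\<zeta>\<close> to \<open>\<zeta> / (z - \<zeta>)\<close>
  sends the unit circle without \<open>z\<close> to the line of real part -1/2. The imaginary part
  is the derivative in \<open>x\<close> of \<open>ln (norm (1 - cis x / cis t))\<close>, which links
  extrema on the circle to an algebraic equation.\<close>

lemma unit_circle_ratio:
  assumes "cis x \<noteq> cis t"
  shows "cis x / (cis t - cis x) = Complex (- 1 / 2) (sin (x - t) / (2 - 2 * cos (x - t)))"
proof -
  \<comment> \<open>Only the angle difference matters: the quotient is
    \<open>1 / (u - 1)\<close>.\<close>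
  define u where "u = cis (t - x)"
  have eq: "cis x / (cis t - cis x) = 1 / (u - 1)"
  proof -
    have "cis t = u * cis x" by (simp add: u_def cis_mult)
    then have "cis t - cis x = (u - 1) * cis x" by (simp add: algebra_simps)
    then show ?thesis by simp
  qed
  have u1: "u \<noteq> 1"
  proof
    assume "u = 1"
    then have "cis x * u = cis x" by simp
    then show False using assms by (simp add: u_def cis_mult)
  qed
  have cos: "cos (x - t) \<noteq> 1"
  proof
    assume *: "cos (x - t) = 1"
    then have "sin (x - t) = 0" using sin_cos_squared_add[of "x - t"] by simp
    with * have "u = 1" by (simp add: u_def complex_eq_iff cos_diff sin_diff mult.commute)
    then show False using u1 by simp
  qed
  have "(u - 1) * Complex (- 1 / 2) (sin (x - t) / (2 - 2 * cos (x - t))) = 1"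
  proof -
    have Re_u: "Re u = cos (x - t)" and Im_u: "Im u = - sin (x - t)"
      by (simp_all add: u_def cos_diff sin_diff mult.commute)
    have "sin (x - t) * sin (x - t) = (1 - cos (x - t)) * (1 + cos (x - t))"
      using sin_cos_squared_add3[of "x - t"] by (simp add: algebra_simps)
    then have s: "sin (x - t) * (sin (x - t) / (2 - 2 * cos (x - t))) = (1 + cos (x - t)) / 2"
      using cos by (simp add: divide_eq_eq)
    have c: "(cos (x - t) - 1) * (sin (x - t) / (2 - 2 * cos (x - t))) = - (sin (x - t) / 2)"
      using cos by (simp add: divide_eq_eq) (simp add: field_simps)
    show ?thesis
      by (rule complex_eqI) (use s c in \<open>simp_all add: Re_u Im_u diff_divide_distrib add_divide_distrib\<close>)
  qed
  then show ?thesis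
    unfolding eq using u1 by (metis eq_iff_diff_eq_0 mult.commute nonzero_divide_eq_eq)
qed

lemma norm_unit_circle_diff:
  "(norm (1 - cis x / cis t))\<^sup>2 = 2 - 2 * cos (x - t)"
proof -
  have "cis x / cis t = cis (x - t)" by (simp add: cis_divide)
  then have "(norm (1 - cis x / cis t))\<^sup>2 = (1 - cos (x - t))\<^sup>2 + (sin (x - t))\<^sup>2"
    by (simp add: cmod_power2)
  then show ?thesis by (simp add: sin_squared_eq power2_eq_square algebra_simps)
qed

text \<open>Both sides have degree at most \<open>card I\<close> and agree at
  \<open>card I + 1\<close> points, namely at 0 and at the roots.\<close>

lemma poly_eq_prod_roots:
  fixes p :: "complex poly"
  assumes "finite I" "degree p \<le> card I" "inj_on c I"
    and "\<And>i. i \<in> I \<Longrightarrow> c i \<noteq> 0 \<and> poly p (c i) = 0" "poly p 0 = 1"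
  shows "poly p w = (\<Prod>i\<in>I. 1 - w / c i)"
proof -
  let ?q = "\<Prod>i\<in>I. [:1, - 1 / c i:]"
  have card: "card (insert 0 (c ` I)) = Suc (card I)"
    using assms by (subst card_insert_disjoint) (auto simp: card_image)
  have "degree ?q \<le> (\<Sum>i\<in>I. degree [:1, - 1 / c i:])"
    using degree_prod_sum_le[OF assms(1), of "\<lambda>i. [:1, - 1 / c i:]"] by (simp add: o_def)
  also have "\<dots> \<le> (\<Sum>i\<in>I. 1)" by (intro sum_mono) simp
  finally have "degree ?q \<le> card I" by simp
  moreover have "poly p x = poly ?q x" if "x \<in> insert 0 (c ` I)" for x
  proof (cases "x = 0")
    case True
    then show ?thesis using assms(5) by (simp add: poly_prod)
  next
    case False
    with that obtain i where i: "i \<in> I" "x = c i" by blast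
    then have "poly ?q x = 0"
      using assms(1,4) by (auto simp: poly_prod intro!: prod_zero bexI[of _ i])
    then show ?thesis using i assms(4) by simp
  qed
  ultimately have "p = ?q"
    using assms(2) card by (intro poly_eqI_degree[of "insert 0 (c ` I)"]) auto
  then show ?thesis by (simp add: poly_prod)
qed

lemma tendsto_within_ball_rotate:
  assumes "(f \<longlongrightarrow> L) (at \<zeta> within ball 0 1)"
  shows "((\<lambda>w. f (cis (- \<alpha>) * w)) \<longlongrightarrow> L) (at (cis \<alpha> * \<zeta>) within ball 0 1)"
proof (rule filterlim_compose[OF assms])
  have "((\<lambda>w. cis (- \<alpha>) * w) \<longlongrightarrow> cis (- \<alpha>) * (cis \<alpha> * \<zeta>)) (at (cis \<alpha> * \<zeta>) within ball 0 1)"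
    by (intro tendsto_intros)
  moreover have "cis (- \<alpha>) * (cis \<alpha> * \<zeta>) = \<zeta>"
    by (simp add: mult.assoc[symmetric] cis_mult)
  moreover have "cis (- \<alpha>) * w \<in> ball 0 1 \<and> cis (- \<alpha>) * w \<noteq> \<zeta>"
    if "w \<in> ball 0 1" "w \<noteq> cis \<alpha> * \<zeta>" for w
  proof -
    have "cis \<alpha> * (cis (- \<alpha>) * w) = w" by (simp add: mult.assoc[symmetric] cis_mult)
    with that show ?thesis by (auto simp: norm_mult)
  qed
  ultimately show "LIM w at (cis \<alpha> * \<zeta>) within ball 0 1. cis (- \<alpha>) * w :> at \<zeta> within ball 0 1"
    unfolding filterlim_at by (auto simp: eventually_at intro!: exI[of _ 1])
qed

lemma unit_circle_within_ball_nontrivial: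
  "norm (\<zeta> :: complex) = 1 \<Longrightarrow> at \<zeta> within ball 0 1 \<noteq> bot"
  using islimpt_ball[of \<zeta> 0 1] trivial_limit_within[of \<zeta> "ball 0 1"] by simp

text \<open>
  The reciprocal of the boundary modulus of a slit map, up to the factor \<open>\<rho>\<^sub>0\<close>; unlike the modulus
  itself it is finite on the whole circle.
\<close>

definition recip_modulus :: "real list \<Rightarrow> complex list \<Rightarrow> complex \<Rightarrow> real" where
  "recip_modulus \<gamma> z \<zeta> = (\<Prod>j<length z. norm (1 - \<zeta> / z ! j) powr (\<gamma> ! j))"

section \<open>Boundary modulus of a slit map and its maxima\<close>

context
  fixes \<phi> f z c
  assumes data: "slit_data \<phi> f z c"
begin

lemma slit_data_length: "length z = length \<phi>" "length c = length \<phi>" "\<phi> \<noteq> []"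
  using data by (auto simp: slit_data_def slit_angles_def)

lemma slit_data_z: "j < length \<phi> \<Longrightarrow> norm (z ! j) = 1 \<and> z ! j \<noteq> 0"
  using data by (force simp: slit_data_def subset_iff)

lemma slit_data_c: "j < length \<phi> \<Longrightarrow> norm (c ! j) = 1 \<and> c ! j \<noteq> 0"
  using data by (force simp: slit_data_def subset_iff)

lemma slit_data_gamma: "j < length \<phi> \<Longrightarrow> gammas \<phi> ! j > 0"
  using data by (simp add: slit_data_def gammas_pos)

lemma slit_data_rho0: "deriv f 0 = of_real (rho0 (gammas \<phi>))" "rho0 (gammas \<phi>) > 0"
  using data rho0_gammas[of \<phi> f] by (auto simp: slit_data_def slit_map_def)

text \<open>Since all gaps are positive, \<open>powr\<close> is continuous even where a factor
  vanishes. So the limit exists at the points of \<open>z\<close> too, with value 0.\<close>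

lemma tendsto_recip_modulus:
  assumes "norm \<zeta> = 1"
  shows "((\<lambda>w. 1 / norm (f w)) \<longlongrightarrow> recip_modulus (gammas \<phi>) z \<zeta> / rho0 (gammas \<phi>)) (at \<zeta> within ball 0 1)"
proof -
  let ?\<rho> = "rho0 (gammas \<phi>)"
  \<comment> \<open>At \<open>w = 0\<close> both sides are 0 by division by zero.\<close>
  have eq: "1 / norm (f w) = recip_modulus (gammas \<phi>) z w / (?\<rho> * norm w)" if "w \<in> ball 0 1" for w
  proof -
    have ne: "1 - w / z ! j \<noteq> 0" if "j < length \<phi>" for j
      using slit_data_z[OF that] \<open>w \<in> ball 0 1\<close> by (auto simp: field_simps)
    have "f w = deriv f 0 * w * (\<Prod>j<length \<phi>. (1 - w / z ! j) powr (- of_real (gammas \<phi> ! j)))"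
      using data that by (simp add: slit_data_def)
    then have "norm (f w) = norm (deriv f 0) * norm w *
        (\<Prod>j<length \<phi>. norm ((1 - w / z ! j) powr (- of_real (gammas \<phi> ! j))))"
      by (simp add: norm_mult prod_norm)
    also have "(\<Prod>j<length \<phi>. norm ((1 - w / z ! j) powr (- of_real (gammas \<phi> ! j))))
        = (\<Prod>j<length \<phi>. inverse (norm (1 - w / z ! j) powr (gammas \<phi> ! j)))"
    proof (rule prod.cong[OF refl])
      fix j assume "j \<in> {..<length \<phi>}"
      then show "norm ((1 - w / z ! j) powr (- of_real (gammas \<phi> ! j))) = inverse (norm (1 - w / z ! j) powr (gammas \<phi> ! j))"
        using norm_powr_of_real[OF ne, of j "- gammas \<phi> ! j"] by (simp add: powr_minus)
    qed
    also have "\<dots> = inverse (recip_modulus (gammas \<phi>) z w)"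
      unfolding recip_modulus_def slit_data_length by (simp add: prod_inversef[symmetric] o_def)
    finally show ?thesis using slit_data_rho0 by (simp add: field_simps)
  qed
  have "((\<lambda>w. recip_modulus (gammas \<phi>) z w / (?\<rho> * norm w)) \<longlongrightarrow>
      recip_modulus (gammas \<phi>) z \<zeta> / (?\<rho> * norm \<zeta>)) (at \<zeta> within ball 0 1)"
    unfolding recip_modulus_def slit_data_length
    using slit_data_gamma slit_data_z slit_data_rho0(2) assms
    by (intro tendsto_intros tendsto_powr') auto
  then have "((\<lambda>w. recip_modulus (gammas \<phi>) z w / (?\<rho> * norm w)) \<longlongrightarrow>
      recip_modulus (gammas \<phi>) z \<zeta> / ?\<rho>) (at \<zeta> within ball 0 1)"
    using assms by simp
  then show ?thesis
    by (rule Lim_transform_eventually) (auto simp: eventually_at eq intro!: exI[of _ 1])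
qed

text \<open>If the limit of \<open>1 / norm (f w)\<close> at \<open>\<zeta>\<close> exceeded some
  \<open>q > 1\<close>, then points near \<open>\<zeta>\<close> would be mapped into the closed disk
  of radius \<open>1 / q\<close>. That disk is a compact part of the slit domain, so its preimage is
  compact in the open unit disk and stays away from \<open>\<zeta>\<close>.\<close>

lemma recip_modulus_le_rho0:
  assumes "norm \<zeta> = 1"
  shows "recip_modulus (gammas \<phi>) z \<zeta> \<le> rho0 (gammas \<phi>)"
proof (rule ccontr)
  let ?L = "recip_modulus (gammas \<phi>) z \<zeta> / rho0 (gammas \<phi>)"
  assume "\<not> ?thesis"
  then have "?L > 1" using slit_data_rho0(2) by simp
  then obtain q where q: "1 < q" "q < ?L" using dense by blast
  have "slit_map \<phi> f" using data by (simp add: slit_data_def)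
  then have hol: "f holomorphic_on ball 0 1" "inj_on f (ball 0 1)" and im: "f ` ball 0 1 = slit_domain \<phi>"
    by (auto simp: slit_map_def conformal_iso_def bij_betw_def)
  obtain k where k: "k holomorphic_on f ` ball 0 1"
      "\<And>w. w \<in> ball 0 1 \<Longrightarrow> deriv f w * deriv k (f w) = 1"
      "\<And>w. w \<in> ball 0 1 \<Longrightarrow> k (f w) = w"
    by (rule holomorphic_has_inverse[OF hol(1) open_ball hol(2)]) (rule that)
  have sub: "cball 0 (1 / q) \<subseteq> slit_domain \<phi>"
  proof -
    have "1 / q < 1" using q by simp
    then have "cball 0 (1 / q) \<subseteq> ball (0::complex) 1" by auto
    then show ?thesis using ball_subset_slit_domain by blast
  qed
  have "k holomorphic_on cball 0 (1 / q)"
    using holomorphic_on_subset[OF k(1)] sub im by simp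
  then have "compact (k ` cball 0 (1 / q))"
    by (intro compact_continuous_image holomorphic_on_imp_continuous_on compact_cball)
  moreover have "\<zeta> \<notin> k ` cball 0 (1 / q)"
  proof
    assume "\<zeta> \<in> k ` cball 0 (1 / q)"
    then obtain v where "v \<in> f ` ball 0 1" "\<zeta> = k v" using sub im by blast
    then show False using k(3) assms by auto
  qed
  ultimately have "eventually (\<lambda>w. w \<in> - k ` cball 0 (1 / q)) (nhds \<zeta>)"
    by (intro eventually_nhds_in_open open_Compl compact_imp_closed) auto
  then have "eventually (\<lambda>w. w \<in> - k ` cball 0 (1 / q)) (at \<zeta> within ball 0 1)"
    by (rule filter_leD[OF at_within_le_nhds])
  moreover have "eventually (\<lambda>w. q < 1 / norm (f w)) (at \<zeta> within ball 0 1)"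
    using order_tendstoD(1)[OF tendsto_recip_modulus[OF assms] q(2)] .
  moreover have "eventually (\<lambda>w. w \<in> ball 0 1) (at \<zeta> within ball 0 1)"
    by (simp add: eventually_at_filter)
  ultimately have "eventually (\<lambda>w. False) (at \<zeta> within ball 0 1)"
  proof eventually_elim
    case (elim w)
    have "norm (f w) > 0" using elim(2) q by (cases "f w = 0") auto
    then have "f w \<in> cball 0 (1 / q)" using elim(2) q by (simp add: field_simps)
    then have "k (f w) \<in> k ` cball 0 (1 / q)" by blast
    then show False using elim(1,3) k(3) by simp
  qed
  then show False using unit_circle_within_ball_nontrivial[OF assms] by (simp add: trivial_limit_def)
qed

text \<open>The boundary value of \<open>f\<close> at a tip has modulus 1, so the bound of
  \<open>recip_modulus_le_rho0\<close> is attained there.\<close>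

lemma recip_modulus_tip:
  assumes "i < length \<phi>"
  shows "recip_modulus (gammas \<phi>) z (c ! i) = rho0 (gammas \<phi>)"
proof -
  have lim: "(f \<longlongrightarrow> cis (\<phi> ! i)) (at (c ! i) within ball 0 1)"
    using data assms by (simp add: slit_data_def)
  have "((\<lambda>w. 1 / norm (f w)) \<longlongrightarrow> 1 / norm (cis (\<phi> ! i))) (at (c ! i) within ball 0 1)"
    by (intro tendsto_intros lim) auto
  then have "1 / norm (cis (\<phi> ! i)) = recip_modulus (gammas \<phi>) z (c ! i) / rho0 (gammas \<phi>)"
    using tendsto_recip_modulus unit_circle_within_ball_nontrivial slit_data_c[OF assms]
    by (metis tendsto_unique)
  then show ?thesis using slit_data_rho0(2) by (simp add: field_simps)
qed

lemma recip_modulus_eq_0_iff: "recip_modulus (gammas \<phi>) z \<zeta> = 0 \<longleftrightarrow> \<zeta> \<in> set z"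
proof -
  have "1 - \<zeta> / z ! j = 0 \<longleftrightarrow> \<zeta> = z ! j" if "j < length z" for j
    using slit_data_z that slit_data_length by (auto simp: field_simps)
  then show ?thesis
    by (auto simp: recip_modulus_def in_set_conv_nth prod_zero_iff)
qed

text \<open>By \<open>recip_modulus_le_rho0\<close> such a point is a maximum of \<^const>\<open>recip_modulus\<close> on the circle.\<close>

lemma tip_critical:
  assumes "norm \<zeta> = 1" "recip_modulus (gammas \<phi>) z \<zeta> = rho0 (gammas \<phi>)"
  shows "\<zeta> \<notin> set z" "(\<Sum>j<length \<phi>. gammas \<phi> ! j * (\<zeta> / (z ! j - \<zeta>))) = -1"
proof -
  show nz: "\<zeta> \<notin> set z" using assms(2) slit_data_rho0(2) recip_modulus_eq_0_iff by force
  define t where "t = (\<lambda>j. Arg (z ! j))"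
  have t: "z ! j = cis (t j)" if "j < length \<phi>" for j
    using slit_data_z[OF that] by (simp add: t_def cis_Arg sgn_div_norm)
  define x where "x = Arg \<zeta>"
  have x: "\<zeta> = cis x" using assms(1) unfolding x_def by (subst cis_Arg) (auto simp: sgn_div_norm)
  have ne: "cis x \<noteq> cis (t j)" if "j < length \<phi>" for j
    using nz x t[OF that] that slit_data_length nth_mem by metis
  \<comment> \<open>The logarithm of \<open>recip_modulus\<close> along the circle, with distances
    expressed by cosines so that it can be differentiated in the angle.\<close>
  define h where "h = (\<lambda>y. \<Sum>j<length \<phi>. gammas \<phi> ! j * (ln (2 - 2 * cos (y - t j)) / 2))"
  have pos: "2 - 2 * cos (y - t j) > 0" if "cis y \<noteq> cis (t j)" for y j
  proof -
    have "1 - cis y / cis (t j) \<noteq> 0" using that by simp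
    then have "(norm (1 - cis y / cis (t j)))\<^sup>2 > 0" by (metis zero_less_power2 norm_eq_zero)
    then show ?thesis unfolding norm_unit_circle_diff .
  qed
  have h_exp: "exp (h y) = recip_modulus (gammas \<phi>) z (cis y)"
    if "\<And>j. j < length \<phi> \<Longrightarrow> cis y \<noteq> cis (t j)" for y
  proof -
    have "exp (gammas \<phi> ! j * (ln (2 - 2 * cos (y - t j)) / 2)) = norm (1 - cis y / z ! j) powr (gammas \<phi> ! j)"
      if j: "j < length \<phi>" for j
    proof -
      have n0: "norm (1 - cis y / cis (t j)) \<noteq> 0" using that \<open>\<And>j. j < length \<phi> \<Longrightarrow> cis y \<noteq> cis (t j)\<close> by simp
      have "ln (2 - 2 * cos (y - t j)) / 2 = ln (norm (1 - cis y / cis (t j)))"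
        unfolding norm_unit_circle_diff[symmetric] using n0 by (simp add: ln_realpow)
      then show ?thesis unfolding t[OF j] powr_def using n0 by simp
    qed
    then show ?thesis
      by (simp add: h_def exp_sum recip_modulus_def slit_data_length)
  qed
  have der: "(h has_field_derivative
      (\<Sum>j<length \<phi>. gammas \<phi> ! j * (sin (x - t j) / (2 - 2 * cos (x - t j))))) (at x)"
    unfolding h_def
  proof (intro DERIV_sum DERIV_cmult)
    fix j assume "j \<in> {..<length \<phi>}"
    then have "2 - 2 * cos (x - t j) > 0" using pos[OF ne] by simp
    then show "((\<lambda>y. ln (2 - 2 * cos (y - t j)) / 2) has_real_derivative
        sin (x - t j) / (2 - 2 * cos (x - t j))) (at x)"
      by (auto intro!: derivative_eq_intros simp: field_simps)
  qed
  \<comment> \<open>The angles that miss all points of \<open>z\<close>. There \<open>h\<close>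
    really is the logarithm of a positive quantity, and openness makes a local maximum at
    \<open>x\<close> meaningful.\<close>
  define U where "U = (\<Inter>j<length \<phi>. {y. cis y \<noteq> cis (t j)})"
  have "open U"
    unfolding U_def by (intro open_INT ballI open_Collect_neq continuous_intros) auto
  moreover have "x \<in> U" using ne by (simp add: U_def)
  ultimately obtain e where e: "e > 0" "ball x e \<subseteq> U" by (auto simp: open_contains_ball)
  have "h y \<le> h x" if "\<bar>x - y\<bar> < e" for y
  proof -
    have "y \<in> U" using e(2) that by (auto simp: dist_real_def)
    then have "exp (h y) \<le> rho0 (gammas \<phi>)"
      by (subst h_exp) (auto simp: U_def intro!: recip_modulus_le_rho0)
    also have "\<dots> = exp (h x)" using assms(2) h_exp[of x] ne by (simp add: x)
    finally show ?thesis by simp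
  qed
  then have 0: "(\<Sum>j<length \<phi>. gammas \<phi> ! j * (sin (x - t j) / (2 - 2 * cos (x - t j)))) = 0"
    using DERIV_local_max[OF der e(1)] by blast
  \<comment> \<open>The imaginary part of this sum is the derivative of \<open>h\<close> at its
    maximum, hence 0. The real part is -1/2 times the sum of the gaps, which is 2.\<close>
  have "(\<Sum>j<length \<phi>. gammas \<phi> ! j * (\<zeta> / (z ! j - \<zeta>))) =
      (\<Sum>j<length \<phi>. gammas \<phi> ! j * Complex (- 1 / 2) (sin (x - t j) / (2 - 2 * cos (x - t j))))"
    using unit_circle_ratio[OF ne] t by (intro sum.cong refl) (simp add: x)
  also have "\<dots> = Complex (- 1) 0"
  proof (rule complex_eqI)
    show "Im (\<Sum>j<length \<phi>. gammas \<phi> ! j * Complex (- 1 / 2) (sin (x - t j) / (2 - 2 * cos (x - t j)))) = Im (Complex (- 1) 0)"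
      using 0 by simp
    show "Re (\<Sum>j<length \<phi>. gammas \<phi> ! j * Complex (- 1 / 2) (sin (x - t j) / (2 - 2 * cos (x - t j)))) = Re (Complex (- 1) 0)"
      using sum_gammas[OF slit_data_length(3)] by (simp add: sum_negf sum_divide_distrib[symmetric])
  qed
  finally show "(\<Sum>j<length \<phi>. gammas \<phi> ! j * (\<zeta> / (z ! j - \<zeta>))) = -1"
    by (simp add: complex_eq_iff)
qed

lemma slit_data_c_inj: "inj_on ((!) c) {..<length \<phi>}"
proof (rule inj_onI)
  fix i k assume ik: "i \<in> {..<length \<phi>}" "k \<in> {..<length \<phi>}" "c ! i = c ! k"
  have "(f \<longlongrightarrow> cis (\<phi> ! j)) (at (c ! j) within ball 0 1)" if "j < length \<phi>" for j
    using data that by (simp add: slit_data_def)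
  from this[of i] this[of k] have "cis (\<phi> ! i) = cis (\<phi> ! k)"
    using ik tendsto_unique[OF unit_circle_within_ball_nontrivial] slit_data_c[of i] by auto
  moreover have "\<phi> ! i \<in> {0..<2 * pi}" "\<phi> ! k \<in> {0..<2 * pi}"
    using data ik by (auto simp: slit_data_def slit_angles_def subset_iff in_set_conv_nth)
  ultimately have "\<phi> ! i = \<phi> ! k" by (intro cis_inj) auto
  moreover have "distinct \<phi>"
    using data by (auto simp: slit_data_def slit_angles_def strict_sorted_iff)
  ultimately show "i = k" using ik by (simp add: nth_eq_iff_index_eq)
qed

lemma slit_data_z_inj: "inj_on ((!) z) {..<length \<phi>}"
  using data by (auto simp: slit_data_def inj_on_def nth_eq_iff_index_eq)

text \<open>This clears denominators in \<open>tip_critical\<close> by multiplying with the product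
  of all \<open>1 - \<zeta> / z ! j\<close>. By the product formula, \<open>1\<close> plus the sum
  of the \<open>gammas \<phi> ! j * (w / (z ! j - w))\<close> is \<open>w f'(w) / f(w)\<close>, so
  the expression is the numerator of the logarithmic derivative.\<close>

lemma tip_polynomial_zero:
  assumes "norm \<zeta> = 1" "recip_modulus (gammas \<phi>) z \<zeta> = rho0 (gammas \<phi>)"
  shows "(\<Prod>j<length \<phi>. 1 - \<zeta> / z ! j) +
     (\<Sum>j<length \<phi>. gammas \<phi> ! j * (\<zeta> / z ! j) * (\<Prod>k\<in>{..<length \<phi>} - {j}. 1 - \<zeta> / z ! k)) = 0"
    (is "?P = 0")
proof -
  let ?m = "length \<phi>"
  note crit = tip_critical[OF assms]
  have "gammas \<phi> ! j * (\<zeta> / z ! j) * (\<Prod>k\<in>{..<?m} - {j}. 1 - \<zeta> / z ! k)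
      = (\<Prod>k<?m. 1 - \<zeta> / z ! k) * (gammas \<phi> ! j * (\<zeta> / (z ! j - \<zeta>)))" if j: "j < ?m" for j
  proof -
    have "z ! j \<noteq> \<zeta>" using crit(1) j slit_data_length nth_mem by metis
    then have *: "(1 - \<zeta> / z ! j) * (\<zeta> / (z ! j - \<zeta>)) = \<zeta> / z ! j"
      using slit_data_z[OF j] by (simp add: field_simps)
    have "(\<Prod>k<?m. 1 - \<zeta> / z ! k) * (gammas \<phi> ! j * (\<zeta> / (z ! j - \<zeta>))) =
        (1 - \<zeta> / z ! j) * (\<Prod>k\<in>{..<?m} - {j}. 1 - \<zeta> / z ! k) * (gammas \<phi> ! j * (\<zeta> / (z ! j - \<zeta>)))"
      using j by (subst prod.remove[of _ j]) auto
    also have "\<dots> = gammas \<phi> ! j * ((1 - \<zeta> / z ! j) * (\<zeta> / (z ! j - \<zeta>))) *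
        (\<Prod>k\<in>{..<?m} - {j}. 1 - \<zeta> / z ! k)"
      by (simp only: mult_ac)
    finally show ?thesis unfolding * ..
  qed
  then have "?P = (\<Prod>k<?m. 1 - \<zeta> / z ! k) * (1 + (\<Sum>j<?m. gammas \<phi> ! j * (\<zeta> / (z ! j - \<zeta>))))"
    by (simp add: sum_distrib_left distrib_left)
  then show ?thesis using crit(2) by simp
qed

lemma tip_product:
  "(\<Prod>j<length \<phi>. 1 - w / z ! j) +
     (\<Sum>j<length \<phi>. gammas \<phi> ! j * (w / z ! j) * (\<Prod>k\<in>{..<length \<phi>} - {j}. 1 - w / z ! k))
   = (\<Prod>i<length \<phi>. 1 - w / c ! i)" (is "?P w = _")
proof -
  let ?m = "length \<phi>"
  \<comment> \<open>The left-hand side as a polynomial object, so that its degree can be bounded. It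
    equals 1 at 0 and vanishes at the distinct points of \<open>c\<close>.\<close>
  define p where "p = (\<Prod>j<?m. [:1, - 1 / z ! j:]) +
     (\<Sum>j<?m. smult (of_real (gammas \<phi> ! j) / z ! j) ([:0, 1:] * (\<Prod>k\<in>{..<?m} - {j}. [:1, - 1 / z ! k:])))"
  have poly_p: "poly p w = ?P w" for w
    by (simp add: p_def poly_prod poly_sum mult_ac)
  have deg1: "degree (\<Prod>j\<in>I. [:1, - 1 / z ! j:]) \<le> card I" if "finite I" for I
  proof -
    have "degree (\<Prod>j\<in>I. [:1, - 1 / z ! j:]) \<le> (\<Sum>j\<in>I. degree [:1, - 1 / z ! j:])"
      using degree_prod_sum_le[OF that, of "\<lambda>j. [:1, - 1 / z ! j:]"] by (simp add: o_def)
    also have "\<dots> \<le> (\<Sum>j\<in>I. 1)" by (intro sum_mono) simp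
    finally show ?thesis by simp
  qed
  have deg: "degree p \<le> ?m"
    unfolding p_def
  proof (intro degree_add_le degree_sum_le)
    show "degree (\<Prod>j<?m. [:1, - 1 / z ! j:]) \<le> ?m" using deg1[of "{..<?m}"] by simp
  next
    fix j assume j: "j \<in> {..<?m}"
    have "degree ([:0, 1:] * (\<Prod>k\<in>{..<?m} - {j}. [:1, - 1 / z ! k:])) \<le> 1 + card ({..<?m} - {j})"
      using deg1[of "{..<?m} - {j}"] degree_mult_le[of "[:0, 1:]" "\<Prod>k\<in>{..<?m} - {j}. [:1, - 1 / z ! k:]"]
      by simp
    also have "\<dots> \<le> ?m" using j by (simp add: card_Diff_singleton)
    finally show "degree (smult (of_real (gammas \<phi> ! j) / z ! j) ([:0, 1:] * (\<Prod>k\<in>{..<?m} - {j}. [:1, - 1 / z ! k:]))) \<le> ?m"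
      using degree_smult_le order_trans by blast
  qed simp
  have "poly p w = (\<Prod>i<?m. 1 - w / c ! i)"
    using deg slit_data_c recip_modulus_tip slit_data_c_inj tip_polynomial_zero
    by (intro poly_eq_prod_roots) (auto simp: poly_p)
  then show ?thesis unfolding poly_p .
qed

text \<open>A maximum is a zero of the tip polynomial, whose zeros are the points of
  \<open>c\<close>. So the set of tips can be read off from \<open>recip_modulus\<close>, as the
  uniqueness of the slit data requires.\<close>

lemma tip_of_recip_modulus_max:
  assumes "norm \<zeta> = 1" "recip_modulus (gammas \<phi>) z \<zeta> = rho0 (gammas \<phi>)"
  shows "\<exists>i<length \<phi>. \<zeta> = c ! i"
proof -
  have "(\<Prod>i<length \<phi>. 1 - \<zeta> / c ! i) = 0"
    using tip_polynomial_zero[OF assms] tip_product[of \<zeta>] by simp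
  then obtain i where "i < length \<phi>" "1 - \<zeta> / c ! i = 0" by (auto simp: prod_zero_iff)
  then show ?thesis using slit_data_c by auto
qed

end

lemma norm_one_minus_divide:
  fixes a b :: complex
  assumes "norm a = 1" "norm b = 1"
  shows "norm (1 - a / b) = norm (b - a)" "norm (1 - a / b) = norm (1 - b / a)"
proof -
  have *: "norm (1 - a / b) = norm (b - a)" if "norm b = 1" for a b :: complex
  proof -
    have "b \<noteq> 0" using that by auto
    then have "1 - a / b = (b - a) / b" by (simp add: diff_divide_distrib)
    then show ?thesis using that by (simp add: norm_divide)
  qed
  show "norm (1 - a / b) = norm (b - a)" "norm (1 - a / b) = norm (1 - b / a)"
    using * assms by (auto simp: norm_minus_commute)
qed

section \<open>Products over the tips and the two special cases\<close>

context
  fixes \<phi> f z c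
  assumes data: "slit_data \<phi> f z c"
begin

lemma rho0_eq_prod_dist:
  assumes "i < length \<phi>"
  shows "rho0 (gammas \<phi>) = (\<Prod>j<length \<phi>. norm (z ! j - c ! i) powr (gammas \<phi> ! j))"
  unfolding recip_modulus_tip[OF data assms, symmetric] recip_modulus_def slit_data_length[OF data]
  using slit_data_z[OF data] slit_data_c[OF data assms]
  by (intro prod.cong refl) (simp add: norm_one_minus_divide(1))

lemma prod_tips_eq:
  assumes j: "j < length \<phi>"
  shows "(\<Prod>i<length \<phi>. norm (1 - c ! i / z ! j)) =
    gammas \<phi> ! j * (\<Prod>k\<in>{..<length \<phi>} - {j}. norm (1 - z ! j / z ! k))"
proof -
  have z: "z ! j \<noteq> 0" "norm (z ! j) = 1" using slit_data_z[OF data j] by auto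
  have "(\<Prod>i<length \<phi>. norm (1 - c ! i / z ! j)) = (\<Prod>i<length \<phi>. norm (1 - z ! j / c ! i))"
    using z slit_data_c[OF data] by (intro prod.cong refl norm_one_minus_divide(2)) auto
  also have "\<dots> = norm (\<Prod>i<length \<phi>. 1 - z ! j / c ! i)" by (simp add: prod_norm)
  also have "(\<Prod>i<length \<phi>. 1 - z ! j / c ! i) =
      gammas \<phi> ! j * (\<Prod>k\<in>{..<length \<phi>} - {j}. 1 - z ! j / z ! k)"
  proof -
    have zero: "(\<Prod>k<length \<phi>. 1 - z ! j / z ! k) = 0"
      using j z by (auto intro!: prod_zero bexI[of _ j])
    \<comment> \<open>For \<open>l\<close> other than \<open>j\<close> the inner product contains
      the factor \<open>1 - z ! j / z ! j\<close>, which is 0.\<close>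
    have single: "(\<Sum>l<length \<phi>. gammas \<phi> ! l * (z ! j / z ! l) * (\<Prod>k\<in>{..<length \<phi>} - {l}. 1 - z ! j / z ! k))
      = gammas \<phi> ! j * (z ! j / z ! j) * (\<Prod>k\<in>{..<length \<phi>} - {j}. 1 - z ! j / z ! k)"
    proof (rule sum.remove[THEN trans])
      have "(\<Sum>l\<in>{..<length \<phi>} - {j}. gammas \<phi> ! l * (z ! j / z ! l) * (\<Prod>k\<in>{..<length \<phi>} - {l}. 1 - z ! j / z ! k)) = 0"
        using j z by (auto intro!: sum.neutral prod_zero bexI[of _ j])
      then show "gammas \<phi> ! j * (z ! j / z ! j) * (\<Prod>k\<in>{..<length \<phi>} - {j}. 1 - z ! j / z ! k) +
        (\<Sum>l\<in>{..<length \<phi>} - {j}. gammas \<phi> ! l * (z ! j / z ! l) * (\<Prod>k\<in>{..<length \<phi>} - {l}. 1 - z ! j / z ! k))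
        = gammas \<phi> ! j * (z ! j / z ! j) * (\<Prod>k\<in>{..<length \<phi>} - {j}. 1 - z ! j / z ! k)"
        by simp
    qed (use j in auto)
    show ?thesis using tip_product[OF data, of "z ! j"] z unfolding zero single by simp
  qed
  also have "norm \<dots> = gammas \<phi> ! j * (\<Prod>k\<in>{..<length \<phi>} - {j}. norm (1 - z ! j / z ! k))"
    using slit_data_gamma[OF data j] by (simp add: norm_mult prod_norm)
  finally show ?thesis .
qed

text \<open>Interchanging the two products leaves one copy of \<open>recip_modulus\<close> per tip,
  and each copy equals \<rho>0.\<close>

lemma rho0_power_length:
  "(\<Prod>j<length \<phi>. (\<Prod>i<length \<phi>. norm (1 - c ! i / z ! j)) powr (gammas \<phi> ! j)) = rho0 (gammas \<phi>) ^ length \<phi>"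
proof -
  have "(\<Prod>j<length \<phi>. (\<Prod>i<length \<phi>. norm (1 - c ! i / z ! j)) powr (gammas \<phi> ! j)) =
      (\<Prod>j<length \<phi>. \<Prod>i<length \<phi>. norm (1 - c ! i / z ! j) powr (gammas \<phi> ! j))"
    by (simp add: prod_powr_distrib)
  also have "\<dots> = (\<Prod>i<length \<phi>. recip_modulus (gammas \<phi>) z (c ! i))"
    unfolding recip_modulus_def slit_data_length[OF data] by (rule prod.swap)
  also have "\<dots> = rho0 (gammas \<phi>) ^ length \<phi>"
    using recip_modulus_tip[OF data] by simp
  finally show ?thesis .
qed

text \<open>
  At a tip, \<open>c / (z\<^sub>j - c)\<close> has real part \<open>-1/2\<close>, so its modulus is governed by its imaginary part, and
  criticality balances the two imaginary parts. Hence the tip closer to one pole is also closer to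
  the other one, unless the distances agree.
\<close>

lemma two_slits_equidistant:
  assumes m: "length \<phi> = 2"
  shows "norm (z ! 0 - c ! 0) = norm (z ! 0 - c ! 1) \<and> norm (z ! 1 - c ! 0) = norm (z ! 1 - c ! 1)"
proof -
  define y where "y = (\<lambda>j i. Im (c ! i / (z ! j - c ! i)))"
  have ne: "z ! j \<noteq> c ! i" if "i < 2" "j < 2" for i j
    using tip_critical(1)[OF data, of "c ! i"] slit_data_c[OF data] recip_modulus_tip[OF data] that m
      slit_data_length[OF data] nth_mem by metis
  have u: "Re (c ! i / (z ! j - c ! i)) = - 1 / 2" if "i < 2" "j < 2" for i j
  proof -
    have "c ! i = cis (Arg (c ! i))" "z ! j = cis (Arg (z ! j))"
      using slit_data_c[OF data] slit_data_z[OF data] that m by (auto simp: cis_Arg sgn_div_norm)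
    then show ?thesis using unit_circle_ratio ne[OF that] by (metis complex.sel(1))
  qed
  have nrm: "(1 / norm (z ! j - c ! i))\<^sup>2 = 1 / 4 + (y j i)\<^sup>2" if "i < 2" "j < 2" for i j
  proof -
    have *: "1 / norm (z ! j - c ! i) = norm (c ! i / (z ! j - c ! i))"
      using slit_data_c[OF data] that m by (simp add: norm_divide)
    show ?thesis unfolding * cmod_power2 u[OF that] y_def by (simp add: power2_eq_square)
  qed
  have bal: "gammas \<phi> ! 0 * \<bar>y 0 i\<bar> = gammas \<phi> ! 1 * \<bar>y 1 i\<bar>" if "i < 2" for i
  proof -
    have "(\<Sum>j<2. gammas \<phi> ! j * (c ! i / (z ! j - c ! i))) = -1"
      using tip_critical(2)[OF data, of "c ! i"] slit_data_c[OF data] recip_modulus_tip[OF data] that m by simp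
    then have "Im (\<Sum>j<2. gammas \<phi> ! j * (c ! i / (z ! j - c ! i))) = 0" by simp
    then have "gammas \<phi> ! 0 * y 0 i + gammas \<phi> ! 1 * y 1 i = 0"
      by (simp add: y_def numeral_2_eq_2 del: times_divide_eq_right)
    then have "gammas \<phi> ! 0 * y 0 i = - (gammas \<phi> ! 1 * y 1 i)" by linarith
    then have "\<bar>gammas \<phi> ! 0 * y 0 i\<bar> = \<bar>gammas \<phi> ! 1 * y 1 i\<bar>" by simp
    then show ?thesis
      using slit_data_gamma[OF data, of 0] slit_data_gamma[OF data, of 1] m by (simp add: abs_mult)
  qed
  have \<gamma>: "gammas \<phi> ! 0 > 0" "gammas \<phi> ! 1 > 0" using slit_data_gamma[OF data] m by auto
  have mono: "norm (z ! j - c ! i) < norm (z ! j - c ! k) \<longleftrightarrow> \<bar>y j i\<bar> > \<bar>y j k\<bar>"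
    if "i < 2" "j < 2" "k < 2" for i j k
  proof -
    have "norm (z ! j - c ! i) < norm (z ! j - c ! k) \<longleftrightarrow>
        \<not> \<bar>1 / norm (z ! j - c ! i)\<bar> \<le> \<bar>1 / norm (z ! j - c ! k)\<bar>"
      using ne that by (auto simp: field_simps)
    also have "\<dots> \<longleftrightarrow> \<not> (y j i)\<^sup>2 \<le> (y j k)\<^sup>2"
      unfolding abs_le_square_iff using nrm that by simp
    also have "\<dots> \<longleftrightarrow> \<bar>y j i\<bar> > \<bar>y j k\<bar>"
      unfolding abs_le_square_iff[symmetric] by linarith
    finally show ?thesis .
  qed
  have same: "\<bar>y 0 i\<bar> > \<bar>y 0 k\<bar> \<longleftrightarrow> \<bar>y 1 i\<bar> > \<bar>y 1 k\<bar>" if "i < 2" "k < 2" for i k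
    using bal[OF that(1)] bal[OF that(2)] \<gamma> by (metis mult_less_cancel_left_pos)
  \<comment> \<open>A tip closer to \<open>z ! 0\<close> is closer to \<open>z ! 1\<close> as well,
    which would make its product of distances strictly smaller. But that product is \<rho>0 for both
    tips.\<close>
  have no: "\<not> norm (z ! 0 - c ! i) < norm (z ! 0 - c ! k)" if "i < 2" "k < 2" for i k
  proof
    assume less: "norm (z ! 0 - c ! i) < norm (z ! 0 - c ! k)"
    then have less': "norm (z ! 1 - c ! i) < norm (z ! 1 - c ! k)"
      using mono same that by simp
    have "norm (z ! 0 - c ! i) powr (gammas \<phi> ! 0) * norm (z ! 1 - c ! i) powr (gammas \<phi> ! 1) <
        norm (z ! 0 - c ! k) powr (gammas \<phi> ! 0) * norm (z ! 1 - c ! k) powr (gammas \<phi> ! 1)"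
      using less less' \<gamma> by (intro mult_strict_mono powr_less_mono2) (auto simp: ne that)
    moreover have "rho0 (gammas \<phi>) = norm (z ! 0 - c ! i) powr (gammas \<phi> ! 0) * norm (z ! 1 - c ! i) powr (gammas \<phi> ! 1)"
      if "i < 2" for i using rho0_eq_prod_dist[of i] that m by (simp add: numeral_2_eq_2)
    ultimately show False using that by (metis less_irrefl)
  qed
  have eq0: "norm (z ! 0 - c ! 0) = norm (z ! 0 - c ! 1)"
    using no[of 0 1] no[of 1 0] by simp
  \<comment> \<open>A strict inequality at \<open>z ! 1\<close> in either direction would carry over
    to \<open>z ! 0\<close>, against \<open>eq0\<close>.\<close>
  moreover have "norm (z ! 1 - c ! 0) = norm (z ! 1 - c ! 1)"
    using mono[of 0 0 1] mono[of 1 0 0] mono[of 0 1 1] mono[of 1 1 0] same[of 0 1] same[of 1 0] eq0 by force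
  ultimately show ?thesis by blast
qed

text \<open>Both poles are equidistant from the two tips, hence have the same square
  \<open>c ! 0 * c ! 1\<close> and are antipodal. The factor 2 is
  \<open>norm (1 - z ! 0 / z ! 1)\<close>.\<close>

lemma prod_tips_two_slits:
  assumes m: "length \<phi> = 2"
  shows "(\<Prod>i<2. norm (1 - c ! i / z ! 0)) = 2 * gammas \<phi> ! 0"
proof -
  \<comment> \<open>Equidistant points \<open>a\<close>, \<open>b\<close> of the circle either
    coincide or are mirror images in the diameter through \<open>w\<close>; in the second case
    \<open>b = w * w / a\<close>.\<close>
  have sq: "w * w = a * b"
    if "norm w = 1" "norm a = 1" "norm b = 1" "a \<noteq> b" "norm (w - a) = norm (w - b)" for w a b :: complex
  proof -
    have *: "norm (w - a) ^ 2 = 2 - 2 * Re (w * cnj a)" if "norm w = 1" "norm a = 1" for w a :: complex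
      using cmod_power2[of w] cmod_power2[of a] that unfolding cmod_power2[of "w - a"]
      by (simp add: power2_eq_square algebra_simps)
    have re: "Re (w * cnj a) = Re (w * cnj b)" using *[of w a] *[of w b] that by simp
    have "norm (w * cnj a) = 1" "norm (w * cnj b) = 1" using that by (simp_all add: norm_mult)
    then have "(Im (w * cnj a))\<^sup>2 = (Im (w * cnj b))\<^sup>2"
      using cmod_power2[of "w * cnj a"] cmod_power2[of "w * cnj b"] re by simp
    then consider "Im (w * cnj a) = Im (w * cnj b)" | "Im (w * cnj a) = - Im (w * cnj b)"
      by (auto simp: power2_eq_iff)
    then show ?thesis
    proof cases
      case 1
      with re have "w * cnj a = w * cnj b" by (intro complex_eqI)
      then show ?thesis using that by (metis complex_cnj_cancel_iff mult_left_cancel norm_zero zero_neq_one)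
    next
      case 2
      with re have "w * cnj a = cnj (w * cnj b)" by (intro complex_eqI) auto
      then have "w * cnj a = cnj w * b" by simp
      have 1: "x * cnj x = 1" if "norm x = 1" for x
        using that complex_norm_square[of x] by simp
      have "w * w = w * w * (a * cnj a)" by (simp add: 1 \<open>norm a = 1\<close>)
      also have "\<dots> = w * cnj a * (w * a)" by (simp only: mult_ac)
      also have "\<dots> = cnj w * b * (w * a)" by (simp only: \<open>w * cnj a = cnj w * b\<close>)
      also have "\<dots> = (w * cnj w) * (a * b)" by (simp only: mult_ac)
      finally show ?thesis by (simp add: 1 \<open>norm w = 1\<close>)
    qed
  qed
  have len: "(0::nat) < length \<phi>" "(1::nat) < length \<phi>" using m by auto
  have c: "c ! 0 \<noteq> c ! 1" using inj_onD[OF slit_data_c_inj[OF data], of 0 1] m by auto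
  have z: "z ! 0 \<noteq> z ! 1" using inj_onD[OF slit_data_z_inj[OF data], of 0 1] m by auto
  have "z ! 0 * z ! 0 = z ! 1 * z ! 1"
    using sq[of "z ! 0" "c ! 0" "c ! 1"] sq[of "z ! 1" "c ! 0" "c ! 1"] c two_slits_equidistant[OF m]
      slit_data_z[OF data len(1)] slit_data_z[OF data len(2)]
      slit_data_c[OF data len(1)] slit_data_c[OF data len(2)] by simp
  then have "z ! 0 = - z ! 1" using z by (simp add: square_eq_iff)
  then have "norm (1 - z ! 0 / z ! 1) = 2" using slit_data_z[OF data len(2)] by simp
  moreover have "{..<2} - {0} = {1::nat}" by auto
  ultimately show ?thesis using prod_tips_eq[OF len(1)] m by simp
qed

text \<open>Rotation by \<open>2 * pi / m\<close> with \<open>m = length \<phi>\<close> permutes the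
  slits, so by uniqueness it commutes with \<open>f\<close> and preserves the points of
  \<open>z\<close>. These are therefore the \<open>m\<close>-th roots of unity times one of them,
  and the product of \<open>1 - z ! j / z ! k\<close> over \<open>k\<close> other than
  \<open>j\<close> is \<open>m\<close>, which the gap \<open>2 / m\<close> reduces to 2.\<close>

lemma prod_tips_equal_gaps:
  assumes eq: "\<And>j. j < length \<phi> \<Longrightarrow> gammas \<phi> ! j = 2 / length \<phi>" and j: "j < length \<phi>"
  shows "(\<Prod>i<length \<phi>. norm (1 - c ! i / z ! j)) = 2"
proof -
  let ?m = "length \<phi>"
  define \<alpha> where "\<alpha> = 2 * pi / ?m"
  have m: "?m > 0" using j by linarith
  have \<phi>: "\<phi> ! k = \<phi> ! 0 + k * \<alpha>" if "k < ?m" for k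
  proof -
    have "(\<phi> ! k - \<phi> ! 0) / pi = (\<Sum>i<k. 2 / ?m)"
      unfolding gammas_partial_sum[OF that, symmetric] using eq that by (intro sum.cong) auto
    then show ?thesis by (simp add: \<alpha>_def field_simps)
  qed
  have rot: "cis ` set \<phi> = (\<lambda>x. cis (\<alpha> + x)) ` set \<phi>"
  proof -
    have step: "cis (\<alpha> + \<phi> ! k) = cis (\<phi> ! (Suc k mod ?m))" if "k < ?m" for k
    proof (cases "Suc k < ?m")
      case True
      then show ?thesis using \<phi>[of k] \<phi>[of "Suc k"] by (simp add: algebra_simps)
    next
      case False
      then have k: "Suc k = ?m" using that by simp
      have "\<alpha> + \<phi> ! k = \<phi> ! 0 + real (Suc k) * \<alpha>" using \<phi>[OF that] by (simp add: algebra_simps)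
      also have "\<dots> = \<phi> ! 0 + 2 * pi" unfolding k using m by (simp add: \<alpha>_def)
      finally have "cis (\<alpha> + \<phi> ! k) = cis (\<phi> ! 0)" by (simp add: cis_mult[symmetric])
      then show ?thesis using k by simp
    qed
    have set: "set \<phi> = (!) \<phi> ` {..<?m}" by (auto simp: set_conv_nth)
    have "(\<lambda>x. cis (\<alpha> + x)) ` set \<phi> = (\<lambda>k. cis (\<phi> ! (Suc k mod ?m))) ` {..<?m}"
      unfolding set image_image using step by (intro image_cong) auto
    also have "\<dots> = (\<lambda>k. cis (\<phi> ! k)) ` (\<lambda>k. Suc k mod ?m) ` {..<?m}" by (simp add: image_image)
    also have "(\<lambda>k. Suc k mod ?m) ` {..<?m} = {..<?m}"
    proof -
      have "k \<in> (\<lambda>k. Suc k mod ?m) ` {..<?m}" if "k < ?m" for k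
      proof (cases k)
        case 0
        then show ?thesis using m by (intro image_eqI[of _ _ "?m - 1"]) auto
      next
        case (Suc l)
        then show ?thesis using that by (intro image_eqI[of _ _ l]) auto
      qed
      then show ?thesis using m by auto
    qed
    finally show ?thesis unfolding set by (simp add: image_image)
  qed
  have sm: "slit_map \<phi> f" using data by (simp add: slit_data_def)
  have f_rot: "f w = cis \<alpha> * f (cis (- \<alpha>) * w)" if "w \<in> ball 0 1" for w
    using slit_map_unique(2)[OF sm slit_map_rotate(1)[OF sm rot] refl that] .
  \<comment> \<open>The modulus of \<open>f\<close> is invariant under the rotation, hence so are
    its limits on the circle.\<close>
  have rm: "recip_modulus (gammas \<phi>) z (cis \<alpha> * \<zeta>) = recip_modulus (gammas \<phi>) z \<zeta>" if "norm \<zeta> = 1" for \<zeta>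
  proof -
    have n: "norm (cis \<alpha> * \<zeta>) = 1" using that by (simp add: norm_mult)
    have "((\<lambda>w. 1 / norm (f (cis (- \<alpha>) * w))) \<longlongrightarrow> recip_modulus (gammas \<phi>) z \<zeta> / rho0 (gammas \<phi>))
        (at (cis \<alpha> * \<zeta>) within ball 0 1)"
      by (rule tendsto_within_ball_rotate[OF tendsto_recip_modulus[OF data that]])
    moreover have "eventually (\<lambda>w. 1 / norm (f (cis (- \<alpha>) * w)) = 1 / norm (f w)) (at (cis \<alpha> * \<zeta>) within ball 0 1)"
    proof (rule eventually_mono)
      show "eventually (\<lambda>w. w \<in> ball 0 1) (at (cis \<alpha> * \<zeta>) within ball 0 1)"
        by (simp add: eventually_at_filter)
      show "1 / norm (f (cis (- \<alpha>) * w)) = 1 / norm (f w)" if "w \<in> ball 0 1" for w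
        using arg_cong[OF f_rot[OF that], of norm] by (simp add: norm_mult)
    qed
    ultimately have "((\<lambda>w. 1 / norm (f w)) \<longlongrightarrow> recip_modulus (gammas \<phi>) z \<zeta> / rho0 (gammas \<phi>))
        (at (cis \<alpha> * \<zeta>) within ball 0 1)"
      by (rule Lim_transform_eventually)
    from tendsto_unique[OF unit_circle_within_ball_nontrivial[OF n] this tendsto_recip_modulus[OF data n]]
    show ?thesis using slit_data_rho0(2)[OF data] by simp
  qed
  have inv: "cis \<alpha> * \<zeta> \<in> set z" if "\<zeta> \<in> set z" for \<zeta>
  proof -
    have "norm \<zeta> = 1" using data that by (force simp: slit_data_def)
    then show ?thesis using rm that recip_modulus_eq_0_iff[OF data] by metis
  qed
  have orbit: "cis (k * \<alpha>) * z ! j \<in> set z" for k :: nat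
  proof (induction k)
    case 0
    then show ?case using j slit_data_length[OF data] by simp
  next
    case (Suc k)
    have "cis (real (Suc k) * \<alpha>) * z ! j = cis \<alpha> * (cis (k * \<alpha>) * z ! j)"
      by (simp add: cis_mult mult.assoc[symmetric] algebra_simps)
    then show ?case using inv[OF Suc] by metis
  qed
  have "inj_on (\<lambda>k. cis (real k * \<alpha>) * z ! j) {..<?m}"
  proof (rule inj_onI)
    fix a b :: nat assume ab: "a \<in> {..<?m}" "b \<in> {..<?m}" "cis (a * \<alpha>) * z ! j = cis (b * \<alpha>) * z ! j"
    then have "cis (a * \<alpha>) = cis (b * \<alpha>)" using slit_data_z[OF data j] by simp
    moreover have "\<bar>real a * \<alpha> - real b * \<alpha>\<bar> < 2 * pi"
    proof -
      have "\<bar>real a - real b\<bar> < ?m" using ab by auto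
      then have "\<bar>real a - real b\<bar> * \<alpha> < ?m * \<alpha>" using m by (intro mult_strict_right_mono) (auto simp: \<alpha>_def)
      moreover have "\<bar>real a * \<alpha> - real b * \<alpha>\<bar> = \<bar>real a - real b\<bar> * \<alpha>"
        using m unfolding left_diff_distrib[symmetric] abs_mult by (simp add: \<alpha>_def)
      ultimately show ?thesis using m by (simp add: \<alpha>_def)
    qed
    ultimately have "a * \<alpha> = b * \<alpha>" by (rule cis_inj)
    then show "a = b" using m by (simp add: \<alpha>_def)
  qed
  \<comment> \<open>The orbit of \<open>z ! j\<close> has as many points as \<open>z\<close>, so it
    exhausts \<open>z\<close>.\<close>
  then have "card ((\<lambda>k. cis (real k * \<alpha>) * z ! j) ` {..<?m}) = card (set z)"
    using data by (simp add: card_image distinct_card slit_data_def)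
  then have set_z: "(\<lambda>k. cis (real k * \<alpha>) * z ! j) ` {..<?m} = set z"
    using orbit by (intro card_subset_eq) auto
  have root: "(z ! j / z ! k) ^ ?m = 1" if "k < ?m" for k
  proof -
    have "z ! k \<in> set z" using that slit_data_length[OF data] by simp
    then obtain l :: nat where l: "z ! k = cis (l * \<alpha>) * z ! j" using set_z by blast
    have "(z ! k) ^ ?m = cis (real ?m * (l * \<alpha>)) * (z ! j) ^ ?m"
      unfolding l power_mult_distrib Complex.DeMoivre ..
    also have "real ?m * (l * \<alpha>) = 2 * pi * l" using m by (simp add: \<alpha>_def)
    also have "cis (2 * pi * l) = 1" by (rule cis_multiple_2pi) simp
    finally show ?thesis using slit_data_z[OF data] that j by (simp add: power_divide)
  qed
  \<comment> \<open>The geometric sum \<open>(1 - x ^ m) / (1 - x)\<close> in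
    \<open>x = w / z ! j\<close>. It vanishes at the other points of \<open>z\<close> and takes the
    value \<open>m\<close> at \<open>z ! j\<close> itself.\<close>
  define p where "p = (\<Sum>l<?m. monom (1 / (z ! j) ^ l) l)"
  have poly_p: "poly p w = (\<Sum>l<?m. (w / z ! j) ^ l)" for w
    by (simp add: p_def poly_sum poly_monom power_divide)
  have "poly p (z ! j) = (\<Prod>k\<in>{..<?m} - {j}. 1 - z ! j / z ! k)"
  proof (rule poly_eq_prod_roots)
    show "degree p \<le> card ({..<?m} - {j})"
      unfolding p_def using j
      by (intro degree_sum_le) (auto intro!: order_trans[OF degree_monom_le] simp: card_Diff_singleton)
    show "inj_on ((!) z) ({..<?m} - {j})"
      using slit_data_z_inj[OF data] by (rule inj_on_subset) auto
    show "poly p 0 = 1"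
      unfolding poly_p using m by (simp add: power_0_left sum.delta)
    fix k assume k: "k \<in> {..<?m} - {j}"
    have "z ! k \<noteq> z ! j"
      using k j slit_data_z_inj[OF data] by (auto simp: inj_on_def)
    moreover have "(z ! k / z ! j) ^ ?m = 1"
      using root[of k] k by (auto simp: power_divide field_simps)
    ultimately show "z ! k \<noteq> 0 \<and> poly p (z ! k) = 0"
      unfolding poly_p using k slit_data_z[OF data, of k] by (simp add: sum_gp_strict)
  qed simp
  moreover have "poly p (z ! j) = ?m" unfolding poly_p using slit_data_z[OF data j] by simp
  ultimately have "norm (\<Prod>k\<in>{..<?m} - {j}. 1 - z ! j / z ! k) = ?m" by (metis norm_of_nat)
  then show ?thesis using prod_tips_eq[OF j] eq[OF j] m by (simp add: prod_norm)
qed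

end

section \<open>Slit data are determined up to rotation by the gaps\<close>

text \<open>The map is unique, hence so is its boundary modulus: zeros of
  \<open>recip_modulus\<close> give the set of \<open>z\<close>, maxima give the tips. The limits of
  \<open>f\<close> at the tips fix the labels of \<open>c\<close>, and the cyclic order then fixes
  those of \<open>z\<close>.\<close>

lemma slit_data_unique:
  assumes D: "slit_data \<phi> f z c" and D': "slit_data \<phi> g z' c'"
  shows "z' = z" "c' = c"
proof -
  let ?m = "length \<phi>"
  note len = slit_data_length[OF D] slit_data_length[OF D']
  have fg: "f w = g w" if "w \<in> ball 0 1" for w
    using slit_map_unique(2)[of \<phi> f \<phi> g w] D D' that by (auto simp: slit_data_def)
  have rm: "recip_modulus (gammas \<phi>) z \<zeta> = recip_modulus (gammas \<phi>) z' \<zeta>" if "norm \<zeta> = 1" for \<zeta>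
  proof -
    have "eventually (\<lambda>w. 1 / norm (f w) = 1 / norm (g w)) (at \<zeta> within ball 0 1)"
      using fg by (auto simp: eventually_at_filter)
    from Lim_transform_eventually[OF tendsto_recip_modulus[OF D that] this]
    show ?thesis
      using tendsto_unique[OF unit_circle_within_ball_nontrivial[OF that] _ tendsto_recip_modulus[OF D' that]]
        slit_data_rho0(2)[OF D] by force
  qed
  have set_z: "set z = set z'"
  proof -
    have "norm \<zeta> = 1" if "\<zeta> \<in> set z \<union> set z'" for \<zeta>
      using D D' that by (force simp: slit_data_def)
    then show ?thesis
      using rm recip_modulus_eq_0_iff[OF D] recip_modulus_eq_0_iff[OF D'] by (metis UnCI subsetI subset_antisym)
  qed
  show c: "c' = c"
  proof (rule nth_equalityI)
    fix i assume "i < length c'"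
    then have i: "i < ?m" using len by simp
    have n: "norm (c' ! i) = 1" using slit_data_c[OF D' i] by simp
    have "recip_modulus (gammas \<phi>) z (c' ! i) = rho0 (gammas \<phi>)"
      using rm[OF n] recip_modulus_tip[OF D' i] by simp
    then obtain k where k: "k < ?m" "c' ! i = c ! k"
      using tip_of_recip_modulus_max[OF D n] by blast
    have "(f \<longlongrightarrow> cis (\<phi> ! k)) (at (c ! k) within ball 0 1)"
      using D k by (simp add: slit_data_def)
    moreover have "(f \<longlongrightarrow> cis (\<phi> ! i)) (at (c ! k) within ball 0 1)"
    proof (rule Lim_transform_eventually)
      show "(g \<longlongrightarrow> cis (\<phi> ! i)) (at (c ! k) within ball 0 1)"
        using D' i k(2) unfolding slit_data_def by metis
      show "eventually (\<lambda>w. g w = f w) (at (c ! k) within ball 0 1)"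
        using fg by (auto simp: eventually_at_filter)
    qed
    ultimately have "cis (\<phi> ! k) = cis (\<phi> ! i)"
      using tendsto_unique unit_circle_within_ball_nontrivial n k(2) by metis
    moreover have "\<phi> ! i \<in> {0..<2 * pi}" "\<phi> ! k \<in> {0..<2 * pi}"
      using D i k by (auto simp: slit_data_def slit_angles_def subset_iff in_set_conv_nth)
    ultimately have "\<phi> ! k = \<phi> ! i" by (intro cis_inj) auto
    moreover have "distinct \<phi>"
      using D by (auto simp: slit_data_def slit_angles_def strict_sorted_iff)
    ultimately show "c' ! i = c ! i" using i k by (simp add: nth_eq_iff_index_eq)
  qed (simp add: len)
  obtain s t where st: "\<And>j. j < ?m \<Longrightarrow> c ! j = cis (s j) \<and> z ! j = cis (t j) \<and> s j < t j"
      "\<And>j. Suc j < ?m \<Longrightarrow> t j < s (Suc j)" "t (?m - 1) < s 0 + 2 * pi"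
    using D unfolding slit_data_def by blast
  obtain s' t' where st': "\<And>j. j < ?m \<Longrightarrow> c' ! j = cis (s' j) \<and> z' ! j = cis (t' j) \<and> s' j < t' j"
      "\<And>j. Suc j < ?m \<Longrightarrow> t' j < s' (Suc j)" "t' (?m - 1) < s' 0 + 2 * pi"
    using D' unfolding slit_data_def by blast
  \<comment> \<open>Stated for arbitrary \<open>a\<close>, \<open>b\<close> because it serves both
    choices of arguments. The conditional lets \<open>k\<close> run past the end, where the next tip
    is the first one after a full turn.\<close>
  have ord: "a j < b j \<and> b j < (if k < ?m then a k else a 0 + 2 * pi) \<and> a 0 \<le> a j \<and> b j < a 0 + 2 * pi"
    if "\<And>j. j < ?m \<Longrightarrow> a j < b j" "\<And>j. Suc j < ?m \<Longrightarrow> b j < a (Suc j)" "b (?m - 1) < a 0 + 2 * pi"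
      "j < k" "j < ?m" for j k and a b :: "nat \<Rightarrow> real"
  proof -
    have step: "a i < a (Suc i)" if "Suc i < ?m" for i
      using \<open>\<And>j. j < ?m \<Longrightarrow> a j < b j\<close>[of i] \<open>\<And>j. Suc j < ?m \<Longrightarrow> b j < a (Suc j)\<close>[of i] that by simp
    have mono: "a i \<le> a l" if "i \<le> l" "l < ?m" for i l
      using that by (induction l rule: dec_induct) (use step in force)+
    have last: "b j < a 0 + 2 * pi"
    proof (cases "Suc j < ?m")
      case True
      then have "b j < a (Suc j)" using that(2) by simp
      also have "\<dots> \<le> a (?m - 1)" using True by (intro mono) auto
      also have "\<dots> < b (?m - 1)" using that(1,5) by simp
      finally show ?thesis using that(3) by simp
    next
      case False
      then have "j = ?m - 1" using that(5) by simp
      then show ?thesis using that(3) by simp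
    qed
    have "b j < a k" if "k < ?m"
      using \<open>\<And>j. Suc j < ?m \<Longrightarrow> b j < a (Suc j)\<close>[of j] mono[of "Suc j" k] that \<open>j < k\<close> by simp
    then show ?thesis using that mono[of 0 j] last by auto
  qed
  have m0: "0 < ?m" using len by simp
  txt \<open>
    All \<open>s j\<close> and \<open>t j\<close> lie in the interval \<open>[s 0, s 0 + 2\<pi>)\<close>, and all \<open>s' j\<close> and \<open>t' j\<close> in its translate
    by \<open>N\<close>; \<^const>\<open>cis\<close> is injective on these intervals.
  \<close>
  define N where "N = s' 0 - s 0"
  have cN: "cis (s 0 + N) = cis (s 0)" using st(1)[OF m0] st'(1)[OF m0] c by (simp add: N_def)
  then have cisN: "cis (x + N) = cis x" for x
  proof -
    have "cis N = 1" using cN by (simp add: cis_mult[symmetric])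
    then show ?thesis by (simp add: cis_mult[symmetric])
  qed
  have o: "s j < t j \<and> t j < (if k < ?m then s k else s 0 + 2 * pi) \<and> s 0 \<le> s j \<and> t j < s 0 + 2 * pi"
    if "j < k" "j < ?m" for j k
    by (rule ord) (use st that in auto)
  have o': "s' j < t' j \<and> t' j < (if k < ?m then s' k else s' 0 + 2 * pi) \<and> s' 0 \<le> s' j \<and> t' j < s' 0 + 2 * pi"
    if "j < k" "j < ?m" for j k
    by (rule ord) (use st' that in auto)
  have sN: "s' j = s j + N" if "j < ?m" for j
  proof (rule cis_inj)
    show "cis (s' j) = cis (s j + N)" unfolding cisN using st(1)[OF that] st'(1)[OF that] c by metis
    show "\<bar>s' j - (s j + N)\<bar> < 2 * pi"
      using o[of j "Suc j"] o'[of j "Suc j"] that by (auto simp: N_def)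
  qed
  show "z' = z"
  proof (rule nth_equalityI)
    fix j assume "j < length z'"
    then have j: "j < ?m" using len by simp
    have "z' ! j \<in> set z" using set_z j len by simp
    then obtain k where k: "k < ?m" "z' ! j = z ! k" using len by (metis in_set_conv_nth)
    have tk: "t' j = t k + N"
    proof (rule cis_inj)
      show "cis (t' j) = cis (t k + N)" unfolding cisN using st(1)[OF k(1)] st'(1)[OF j] k(2) by metis
      show "\<bar>t' j - (t k + N)\<bar> < 2 * pi"
        using o[of k "Suc k"] o'[of j "Suc j"] j k(1) by (auto simp: N_def)
    qed
    \<comment> \<open>After the shift by \<open>N\<close>, \<open>t' j\<close> lies between the tips
      \<open>j\<close> and \<open>j + 1\<close> and \<open>t k\<close> between the tips
      \<open>k\<close> and \<open>k + 1\<close>; these arcs are disjoint unless the indices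
      agree.\<close>
    have "k = j"
    proof (rule ccontr)
      assume "k \<noteq> j"
      then consider "k < j" | "j < k" by linarith
      then show False
      proof cases
        case 1
        then show ?thesis using o[of k j] o'[of j "Suc j"] sN[OF j] tk j k(1) by auto
      next
        case 2
        then show ?thesis using o[of k "Suc k"] o'[of j k] sN[OF k(1)] tk j k(1) by auto
      qed
    qed
    then show "z' ! j = z ! j" using k by simp
  qed (simp add: len)
qed

lemma slit_data_rotate:
  assumes D: "slit_data \<phi> f z c" and \<psi>: "\<psi> = map (\<lambda>x. \<alpha> + x) \<phi>" "slit_angles \<psi>" and \<gamma>: "gammas \<psi> = gammas \<phi>"
  shows "slit_data \<psi> (\<lambda>w. cis \<alpha> * f (cis (- \<alpha>) * w)) (map (\<lambda>x. cis \<alpha> * x) z) (map (\<lambda>x. cis \<alpha> * x) c)"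
proof -
  let ?g = "\<lambda>w. cis \<alpha> * f (cis (- \<alpha>) * w)"
  have sm: "slit_map \<phi> f" using D by (simp add: slit_data_def)
  have rot: "cis ` set \<psi> = (\<lambda>x. cis (\<alpha> + x)) ` set \<phi>" unfolding \<psi>(1) by (simp add: image_image)
  note g = slit_map_rotate[OF sm rot]
  note len = slit_data_length[OF D]
  have eq: "?g w = deriv ?g 0 * w *
      (\<Prod>j<length \<psi>. (1 - w / map (\<lambda>x. cis \<alpha> * x) z ! j) powr (- of_real (gammas \<psi> ! j)))"
    if "w \<in> ball 0 1" for w
  proof -
    have "cis (- \<alpha>) * w \<in> ball 0 1" using that by (simp add: norm_mult)
    then have "f (cis (- \<alpha>) * w) = deriv f 0 * (cis (- \<alpha>) * w) *
        (\<Prod>j<length \<phi>. (1 - cis (- \<alpha>) * w / z ! j) powr (- of_real (gammas \<phi> ! j)))"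
      using D by (simp add: slit_data_def)
    moreover have "cis (- \<alpha>) * w / x = w / (cis \<alpha> * x)" for x
      unfolding cis_inverse[symmetric] divide_inverse inverse_mult_distrib by (simp only: mult_ac)
    moreover have "cis \<alpha> * (deriv f 0 * (cis (- \<alpha>) * w) * X) = deriv f 0 * w * X" for X
    proof -
      have "cis \<alpha> * (deriv f 0 * (cis (- \<alpha>) * w) * X) = (cis \<alpha> * cis (- \<alpha>)) * (deriv f 0 * w * X)"
        by (simp only: mult_ac)
      then show ?thesis by (simp add: cis_mult)
    qed
    ultimately show ?thesis using len unfolding g(2) \<gamma> by (simp add: \<psi>(1) cis_mult)
  qed
  have lim: "(?g \<longlongrightarrow> cis (\<psi> ! j)) (at (cis \<alpha> * c ! j) within ball 0 1)" if "j < length \<phi>" for j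
  proof -
    have "(f \<longlongrightarrow> cis (\<phi> ! j)) (at (c ! j) within ball 0 1)" using D that by (simp add: slit_data_def)
    from tendsto_mult[OF tendsto_const tendsto_within_ball_rotate[OF this, of \<alpha>], of "cis \<alpha>"]
    show ?thesis using that by (simp add: \<psi>(1) cis_mult)
  qed
  obtain s t where st: "\<And>j. j < length \<phi> \<Longrightarrow> c ! j = cis (s j) \<and> z ! j = cis (t j) \<and> s j < t j"
      "\<And>j. Suc j < length \<phi> \<Longrightarrow> t j < s (Suc j)" "t (length \<phi> - 1) < s 0 + 2 * pi"
    using D unfolding slit_data_def by blast
  have "\<exists>s t. (\<forall>j<length \<psi>. map (\<lambda>x. cis \<alpha> * x) c ! j = cis (s j) \<and> map (\<lambda>x. cis \<alpha> * x) z ! j = cis (t j) \<and> s j < t j) \<and>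
      (\<forall>j. Suc j < length \<psi> \<longrightarrow> t j < s (Suc j)) \<and> t (length \<psi> - 1) < s 0 + 2 * pi"
    by (rule exI[of _ "\<lambda>j. \<alpha> + s j"], rule exI[of _ "\<lambda>j. \<alpha> + t j"])
      (use st len in \<open>auto simp: \<psi>(1) cis_mult\<close>)
  moreover have "distinct (map (\<lambda>x. cis \<alpha> * x) z)"
    using D by (auto simp: slit_data_def distinct_map inj_on_def)
  moreover have "set (map (\<lambda>x. cis \<alpha> * x) z) \<subseteq> sphere 0 1" "set (map (\<lambda>x. cis \<alpha> * x) c) \<subseteq> sphere 0 1"
    using D by (auto simp: slit_data_def norm_mult)
  ultimately show ?thesis
    unfolding slit_data_def using \<psi>(2) g(1) eq lim len by (simp add: \<psi>(1))
qed

text \<open>The description in \<open>slit_coeff\<close> ranges over all angle lists with these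
  gaps. They are rotations of each other, rotated data are again slit data and hence the only ones,
  and the quotients \<open>c ! i / z ! j\<close> do not change.\<close>

lemma slit_coeff_eq:
  assumes D: "slit_data \<phi> f z c" and j: "j < length \<phi>"
  shows "slit_coeff (gammas \<phi>) j = (\<Prod>i<length \<phi>. norm (1 - c ! i / z ! j))"
  unfolding slit_coeff_def
proof (rule the_equality)
  show "\<exists>\<psi> g z' c'. slit_data \<psi> g z' c' \<and> gammas \<psi> = gammas \<phi> \<and>
      (\<Prod>i<length \<phi>. norm (1 - c ! i / z ! j)) = (\<Prod>i<length \<psi>. norm (1 - c' ! i / z' ! j))"
    using D by blast
next
  fix a assume "\<exists>\<psi> g z' c'. slit_data \<psi> g z' c' \<and> gammas \<psi> = gammas \<phi> \<and>
      a = (\<Prod>i<length \<psi>. norm (1 - c' ! i / z' ! j))"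
  then obtain \<psi> g z' c' where D': "slit_data \<psi> g z' c'" and \<gamma>: "gammas \<psi> = gammas \<phi>"
    and a: "a = (\<Prod>i<length \<psi>. norm (1 - c' ! i / z' ! j))" by blast
  define \<alpha> where "\<alpha> = \<psi> ! 0 - \<phi> ! 0"
  have \<psi>: "\<psi> = map (\<lambda>x. \<alpha> + x) \<phi>"
    using gammas_eq_imp_shift[of \<phi> \<psi>] slit_data_length[OF D] \<gamma> by (simp add: \<alpha>_def)
  have "slit_angles \<psi>" using D' by (simp add: slit_data_def)
  from slit_data_unique[OF slit_data_rotate[OF D \<psi> this \<gamma>] D']
  have "z' = map (\<lambda>x. cis \<alpha> * x) z" "c' = map (\<lambda>x. cis \<alpha> * x) c" by auto
  then show "a = (\<Prod>i<length \<phi>. norm (1 - c ! i / z ! j))"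
    unfolding a using slit_data_length[OF D] j by (simp add: \<psi>)
qed

section \<open>Inclusion-exclusion over roots of unity\<close>

definition root_angle_set :: "nat \<Rightarrow> real set" where
  "root_angle_set n = {\<alpha> \<in> {0..<2 * pi}. cis (real n * \<alpha>) = 1}"

lemma ex_root_of_unity_index:
  assumes "n \<ge> 1" "z ^ n = 1"
  shows "\<exists>k<n. z = cis (2 * pi * real k / real n)"
proof -
  have "bij_betw (\<lambda>k. cis (2 * pi * real k / real n)) {..<n} {z. z ^ n = 1}"
    using assms by (intro Complex.bij_betw_roots_unity) simp
  then show ?thesis using assms(2) unfolding bij_betw_def by blast
qed

lemma root_angle_set_eq:
  assumes "n \<ge> 1"
  shows "root_angle_set n = (\<lambda>k. 2 * pi * real k / real n) ` {..<n}"
proof (intro set_eqI iffI)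
  fix \<alpha> assume \<alpha>: "\<alpha> \<in> root_angle_set n"
  then have "cis \<alpha> ^ n = 1" by (simp add: root_angle_set_def Complex.DeMoivre)
  then obtain k where k: "k < n" "cis \<alpha> = cis (2 * pi * real k / real n)"
    using ex_root_of_unity_index[OF assms] by blast
  have "2 * pi * real k / real n < 2 * pi" using k(1) by (simp add: field_simps)
  moreover have "2 * pi * real k / real n \<ge> 0" by simp
  moreover have "0 \<le> \<alpha>" "\<alpha> < 2 * pi" using \<alpha> by (auto simp: root_angle_set_def)
  ultimately have "\<bar>\<alpha> - 2 * pi * real k / real n\<bar> < 2 * pi" by linarith
  then have "\<alpha> = 2 * pi * real k / real n" using k(2) by (intro cis_inj)
  then show "\<alpha> \<in> (\<lambda>k. 2 * pi * real k / real n) ` {..<n}" using k(1) by blast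
next
  fix \<alpha> assume "\<alpha> \<in> (\<lambda>k. 2 * pi * real k / real n) ` {..<n}"
  then obtain k where k: "k < n" "\<alpha> = 2 * pi * real k / real n" by blast
  have "real n * \<alpha> = 2 * pi * real k" using k by simp
  then have "cis (real n * \<alpha>) = 1" by simp
  moreover have "0 \<le> \<alpha>" "\<alpha> < 2 * pi" unfolding k(2) using k(1) by (simp_all add: field_simps)
  ultimately show "\<alpha> \<in> root_angle_set n" by (simp add: root_angle_set_def)
qed

lemma finite_root_angle_set: "n \<ge> 1 \<Longrightarrow> finite (root_angle_set n)"
  by (simp add: root_angle_set_eq)

lemma card_root_angle_set_le: "n \<ge> 1 \<Longrightarrow> card (root_angle_set n) \<le> n"
  using card_image_le[of "{..<n}" "\<lambda>k. 2 * pi * real k / real n"] by (simp add: root_angle_set_eq)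

lemma root_angles_alt:
  "root_angles n m = {\<phi>. length \<phi> = m \<and> \<phi> \<noteq> [] \<and> sorted_wrt (<) \<phi> \<and> set \<phi> \<subseteq> root_angle_set n}"
  by (auto simp: root_angles_def slit_angles_def root_angle_set_def)

lemma finite_root_angles: "n \<ge> 1 \<Longrightarrow> finite (root_angles n m)"
  using finite_lists_length_eq[OF finite_root_angle_set, of n m]
  by (rule rev_finite_subset) (auto simp: root_angles_alt)

text \<open>The union in (a) runs over all real angles; this picks a representative in
  \<open>[0, 2 * pi)\<close>, which makes the union finite.\<close>

lemma ex_root_angle:
  assumes "n \<ge> 1" "cis (real n * \<theta>) = 1"
  shows "\<exists>\<alpha>\<in>root_angle_set n. cis \<alpha> = cis \<theta>"
proof -
  have "cis \<theta> ^ n = 1" using assms(2) by (simp add: Complex.DeMoivre)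
  then obtain k where "k < n" "cis \<theta> = cis (2 * pi * real k / real n)"
    using ex_root_of_unity_index[OF assms(1)] by blast
  then show ?thesis unfolding root_angle_set_eq[OF assms(1)] by auto
qed

text \<open>Inclusion-exclusion yields a sum over nonempty sets of slits; sorting turns such a set
  into a strictly increasing list. The exponents of -1 differ by 2.\<close>

lemma sum_subsets_eq_sum_root_angles:
  fixes h :: "real set \<Rightarrow> real"
  assumes "n \<ge> 1"
  shows "(\<Sum>S | S \<subseteq> root_angle_set n \<and> S \<noteq> {}. (-1) ^ (card S + 1) * h S) =
    (\<Sum>m=1..n. (-1) ^ (m - 1) * (\<Sum>\<phi>\<in>root_angles n m. h (set \<phi>)))"
proof -
  note fin = finite_root_angle_set[OF assms]
  have "(\<Sum>S | S \<subseteq> root_angle_set n \<and> S \<noteq> {}. (-1) ^ (card S + 1) * h S) =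
      (\<Sum>(m, \<phi>)\<in>Sigma {1..n} (root_angles n). (-1) ^ (m - 1) * h (set \<phi>))"
  proof (rule sum.reindex_bij_witness[of _ "\<lambda>(m, \<phi>). set \<phi>" "\<lambda>S. (card S, sorted_list_of_set S)"])
    fix S assume S: "S \<in> {S. S \<subseteq> root_angle_set n \<and> S \<noteq> {}}"
    then have fS: "finite S" "S \<noteq> {}" using fin finite_subset by auto
    then show "(case (card S, sorted_list_of_set S) of (m, \<phi>) \<Rightarrow> set \<phi>) = S" by simp
    have "card S \<le> n" using S card_mono[OF fin, of S] card_root_angle_set_le[OF assms] by simp
    moreover have "card S \<ge> 1" using fS by (simp add: Suc_le_eq card_gt_0_iff)
    ultimately show "(card S, sorted_list_of_set S) \<in> Sigma {1..n} (root_angles n)"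
      using S fS by (auto simp: root_angles_alt)
    have "(-1::real) ^ (card S + 1) = (-1) ^ (card S - 1)"
      using \<open>card S \<ge> 1\<close> by (cases "card S") auto
    then show "(case (card S, sorted_list_of_set S) of (m, \<phi>) \<Rightarrow> (-1) ^ (m - 1) * h (set \<phi>)) =
        (-1) ^ (card S + 1) * h S"
      using fS by simp
  next
    fix x assume "x \<in> Sigma {1..n} (root_angles n)"
    then obtain m \<phi> where x: "x = (m, \<phi>)" "\<phi> \<in> root_angles n m" by auto
    then have \<phi>: "length \<phi> = m" "\<phi> \<noteq> []" "sorted_wrt (<) \<phi>" "set \<phi> \<subseteq> root_angle_set n"
      by (auto simp: root_angles_alt)
    show "(case x of (m, \<phi>) \<Rightarrow> set \<phi>) \<in> {S. S \<subseteq> root_angle_set n \<and> S \<noteq> {}}"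
      using \<phi> by (simp add: x)
    show "(card (case x of (m, \<phi>) \<Rightarrow> set \<phi>), sorted_list_of_set (case x of (m, \<phi>) \<Rightarrow> set \<phi>)) = x"
      using \<phi> by (simp add: x distinct_card strict_sorted_iff sorted_list_of_set.idem_if_sorted_distinct)
  qed
  also have "\<dots> = (\<Sum>m=1..n. \<Sum>\<phi>\<in>root_angles n m. (-1) ^ (m - 1) * h (set \<phi>))"
    using finite_root_angles[OF assms] by (subst sum.Sigma) auto
  finally show ?thesis by (simp add: sum_distrib_left)
qed

section \<open>Loops in slit domains and their measure\<close>

text \<open>The index set is arbitrary, so countable unions do not suffice. The union is instead the
  intersection of one Borel set, the loops around the origin, with a union of open sets.\<close>

lemma UN_loops1_in_borel_loops:
  assumes "\<And>i. i \<in> I \<Longrightarrow> open (W i)" "\<And>i. i \<in> I \<Longrightarrow> W i \<subseteq> - {0}"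
  shows "(\<Union>i\<in>I. loops1 (W i)) \<in> borel_loops (- {0})"
proof -
  interpret sigma_algebra "loops (top_of_set (- {0 :: complex}))" "borel_loops (- {0})"
    by (rule sigma_algebra_borel_loops)
  have "openin (loop_topology (top_of_set (- {0}))) (\<Union>i\<in>I. loops (top_of_set (W i)))"
    using assms by (intro openin_Union) (auto intro!: openin_loop_topology_loops)
  then have "(\<Union>i\<in>I. loops (top_of_set (W i))) \<in> borel_loops (- {0})"
    by (simp add: borel_loops_def sigma_sets.Basic)
  moreover have "loops1 (- {0}) \<in> borel_loops (- {0})"
    by (intro loops1_in_borel_loops) auto
  ultimately have "loops1 (- {0}) \<inter> (\<Union>i\<in>I. loops (top_of_set (W i))) \<in> borel_loops (- {0})"
    by (rule Int[rotated])
  also have "loops1 (- {0}) \<inter> (\<Union>i\<in>I. loops (top_of_set (W i))) = (\<Union>i\<in>I. loops1 (W i))"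
    using assms(2) by (fastforce simp: mem_loops1_iff loops_top_of_set)
  finally show ?thesis .
qed

text \<open>The set measured by Werner's formula when \<open>U\<close> is the unit disk and
  \<open>V\<close> the slit domain.\<close>

definition slit_loops :: "real list \<Rightarrow> complex set set" where
  "slit_loops \<phi> = loops1 (slit_domain \<phi> - {0}) - loops (top_of_set (ball 0 1))"

lemma mem_slit_loops:
  "K \<in> slit_loops \<phi> \<longleftrightarrow> K \<in> loops1 (- {0}) \<and> K \<subseteq> slit_domain \<phi> \<and> \<not> K \<subseteq> ball 0 1"
  by (auto simp: slit_loops_def mem_loops1_iff loops_top_of_set)

lemma INT_slit_loops:
  assumes "\<phi> \<noteq> []"
  shows "(\<Inter>\<alpha>\<in>set \<phi>. slit_loops [\<alpha>]) = slit_loops \<phi>"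
proof -
  have "K \<subseteq> slit_domain \<phi> \<longleftrightarrow> (\<forall>\<alpha>\<in>set \<phi>. K \<subseteq> slit_domain [\<alpha>])" for K
    by (auto simp: slit_domain_def)
  moreover have "set \<phi> \<noteq> {}" using assms by simp
  ultimately show ?thesis unfolding set_eq_iff INT_iff mem_slit_loops by blast
qed

lemma closed_unit_slit: "closed ({0} \<union> {of_real t * cis \<theta> | t. 0 < t \<and> t \<le> 1})"
proof -
  have "{0} \<union> {of_real t * cis \<theta> | t. 0 < t \<and> t \<le> 1} = (\<lambda>t. of_real t * cis \<theta>) ` {0..1}"
    by (force simp: image_iff)
  moreover have "compact ((\<lambda>t. complex_of_real t * cis \<theta>) ` {0..1})"
    by (intro compact_continuous_image continuous_intros) auto
  ultimately show ?thesis by (simp add: compact_imp_closed)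
qed

text \<open>Inversion carries \<open>(0, 1]\<close> times \<open>cis \<theta>\<close> to the ray
  from \<open>cis (- \<theta>)\<close> to infinity and the exterior of the closed unit disk to the
  punctured disk. Passing to \<open>- \<theta>\<close> permutes the roots of unity, so the unions
  correspond although single members need not.\<close>

lemma inverse_image_UN_loops:
  assumes n: "n \<ge> 1"
  shows "(\<lambda>K. inverse ` K) ` (\<Union>\<theta>\<in>{\<theta>. cis (real n * \<theta>) = 1}.
      loops1 (- {0} - {of_real t * cis \<theta> | t. 0 < t \<and> t \<le> 1}) - loops (top_of_set {w. cmod w > 1})) =
    (\<Union>\<alpha>\<in>root_angle_set n. slit_loops [\<alpha>])" (is "_ ` ?U = ?V")
proof -
  have mem_U: "K \<in> ?U \<longleftrightarrow> K \<in> loops1 (- {0}) \<and> (\<exists>x\<in>K. cmod x \<le> 1) \<and>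
      (\<exists>\<theta>. cis (real n * \<theta>) = 1 \<and> (\<forall>x\<in>K. \<forall>t. 0 < t \<and> t \<le> 1 \<longrightarrow> x \<noteq> of_real t * cis \<theta>))" for K
  proof -
    have "K \<subseteq> - {0} - {of_real t * cis \<theta> | t. 0 < t \<and> t \<le> 1} \<longleftrightarrow>
        K \<subseteq> - {0} \<and> (\<forall>x\<in>K. \<forall>t. 0 < t \<and> t \<le> 1 \<longrightarrow> x \<noteq> of_real t * cis \<theta>)" for \<theta>
      by blast
    moreover have "\<not> K \<subseteq> {w. cmod w > 1} \<longleftrightarrow> (\<exists>x\<in>K. cmod x \<le> 1)"
      by (auto simp: not_less)
    ultimately show ?thesis
      unfolding UN_iff Diff_iff mem_loops1_iff loops_top_of_set mem_Collect_eq by blast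
  qed
  have mem_V: "K \<in> ?V \<longleftrightarrow> K \<in> loops1 (- {0}) \<and> (\<exists>x\<in>K. cmod x \<ge> 1) \<and>
      (\<exists>\<alpha>\<in>root_angle_set n. \<forall>x\<in>K. \<forall>t\<ge>1. x \<noteq> of_real t * cis \<alpha>)" for K
  proof -
    have "K \<subseteq> slit_domain [\<alpha>] \<longleftrightarrow> (\<forall>x\<in>K. \<forall>t\<ge>1. x \<noteq> of_real t * cis \<alpha>)" for \<alpha>
      unfolding slit_domain_def by auto
    moreover have "\<not> K \<subseteq> ball 0 1 \<longleftrightarrow> (\<exists>x\<in>K. cmod x \<ge> 1)"
      by (auto simp: not_less)
    ultimately show ?thesis
      unfolding UN_iff mem_slit_loops by blast
  qed
  have UV: "inverse ` K \<in> ?V" if "K \<in> ?U" for K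
  proof -
    from that obtain x \<theta> where K: "K \<in> loops1 (- {0})" and x: "x \<in> K" "cmod x \<le> 1"
      and \<theta>: "cis (real n * \<theta>) = 1" "\<And>x t. x \<in> K \<Longrightarrow> 0 < t \<Longrightarrow> t \<le> 1 \<Longrightarrow> x \<noteq> of_real t * cis \<theta>"
      unfolding mem_U by blast
    from arg_cong[OF \<theta>(1), of inverse] have "cis (real n * (- \<theta>)) = 1" by simp
    then obtain \<alpha> where \<alpha>: "\<alpha> \<in> root_angle_set n" "cis \<alpha> = cis (- \<theta>)"
      using ex_root_angle[OF n] by blast
    have avoid: "inverse y \<noteq> of_real t * cis \<alpha>" if "y \<in> K" "t \<ge> 1" for y t
    proof
      assume "inverse y = of_real t * cis \<alpha>"
      then have "y = inverse (of_real t * cis (- \<theta>))" by (metis \<alpha>(2) inverse_inverse_eq)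
      then have "y = of_real (inverse t) * cis \<theta>" by simp
      then show False using \<theta>(2)[OF that(1), of "inverse t"] that(2) by (simp add: inverse_le_1_iff)
    qed
    have big: "cmod (inverse x) \<ge> 1"
    proof -
      have "x \<noteq> 0" using K x by (auto simp: mem_loops1_iff)
      then show ?thesis using x(2) by (simp add: norm_inverse one_le_inverse)
    qed
    show ?thesis
      unfolding mem_V
    proof (intro conjI bexI[of _ "inverse x"] bexI[of _ \<alpha>])
      show "\<forall>y\<in>inverse ` K. \<forall>t\<ge>1. y \<noteq> of_real t * cis \<alpha>"
        by (simp add: avoid)
    qed (fact inverse_image_mem_loops1[OF K] big imageI[OF x(1)] \<alpha>(1))+
  qed
  have VU: "inverse ` K \<in> ?U" if "K \<in> ?V" for K
  proof -
    from that obtain x \<alpha> where K: "K \<in> loops1 (- {0})" and x: "x \<in> K" "cmod x \<ge> 1"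
      and \<alpha>: "\<alpha> \<in> root_angle_set n" "\<And>x t. x \<in> K \<Longrightarrow> t \<ge> 1 \<Longrightarrow> x \<noteq> of_real t * cis \<alpha>"
      unfolding mem_V by blast
    have "cis (real n * \<alpha>) = 1" using \<alpha>(1) by (simp add: root_angle_set_def)
    from arg_cong[OF this, of inverse] have \<theta>: "cis (real n * (- \<alpha>)) = 1" by simp
    have avoid: "inverse y \<noteq> of_real t * cis (- \<alpha>)" if "y \<in> K" "0 < t" "t \<le> 1" for y t
    proof
      assume "inverse y = of_real t * cis (- \<alpha>)"
      then have "y = inverse (of_real t * cis (- \<alpha>))" by (metis inverse_inverse_eq)
      then have "y = of_real (inverse t) * cis \<alpha>" by simp
      then show False using \<alpha>(2)[OF that(1), of "inverse t"] that(2,3) by (simp add: one_le_inverse)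
    qed
    have small: "cmod (inverse x) \<le> 1" using x(2) by (simp add: norm_inverse inverse_le_1_iff)
    show ?thesis
      unfolding mem_U
    proof (intro conjI bexI[of _ "inverse x"] exI[of _ "- \<alpha>"])
      show "\<forall>y\<in>inverse ` K. \<forall>t. 0 < t \<and> t \<le> 1 \<longrightarrow> y \<noteq> of_real t * cis (- \<alpha>)"
        by (simp add: avoid del: cis_cnj)
    qed (fact inverse_image_mem_loops1[OF K] small imageI[OF x(1)] \<theta>)+
  qed
  show ?thesis
  proof
    show "(\<lambda>K. inverse ` K) ` ?U \<subseteq> ?V" using UV by (rule image_subsetI)
    show "?V \<subseteq> (\<lambda>K. inverse ` K) ` ?U"
    proof
      fix K assume K: "K \<in> ?V"
      \<comment> \<open>Inversion is an involution, so \<open>VU\<close> provides a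
        preimage.\<close>
      have "K = inverse ` inverse ` K" by (simp add: image_image)
      then show "K \<in> (\<lambda>K. inverse ` K) ` ?U" using VU[OF K] by (rule image_eqI)
    qed
  qed
qed

context
  fixes \<mu> :: loop_measure_family
  assumes \<mu>: "werner_family \<mu>"
begin

lemma slit_loops_in_sets: "slit_loops \<phi> \<in> sets (\<mu> plane)"
proof -
  have "open (slit_domain \<phi> - {0})" using open_slit_domain by (simp add: open_delete)
  then show ?thesis
    unfolding slit_loops_def
    by (intro sets.Diff) (auto simp: sets_plane[OF \<mu>] intro!: loops1_in_borel_loops loops_in_borel_loops)
qed

text \<open>Werner's formula applied to the slit map itself. The logarithm is nonnegative because it
  is the value of a measure; this guards against truncation by \<open>ennreal\<close>.\<close>

lemma emeasure_slit_loops: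
  assumes "slit_angles \<phi>"
  shows "emeasure (\<mu> plane) (slit_loops \<phi>) = ennreal (ln (rho0 (gammas \<phi>)))" "ln (rho0 (gammas \<phi>)) \<ge> 0"
proof -
  have ne: "\<phi> \<noteq> []" using assms by (simp add: slit_angles_def)
  obtain f where f: "slit_map \<phi> f" using ex_slit_map[OF ne] by blast
  have "werner_formula (mu0 \<mu>)" using \<mu> by (simp add: werner_family_def)
  then have "enn2ereal (emeasure (mu0 \<mu>) (loops1 (slit_domain \<phi> - {0}) - loops (top_of_set (ball 0 1)))) =
      ereal (ln (cmod (deriv f 0)))"
    unfolding werner_formula_def
  proof (elim allE impE)
    let ?B = "ball 0 1 :: complex set"
    show "open ?B \<and> simply_connected ?B \<and> open (slit_domain \<phi>) \<and>
        simply_connected (slit_domain \<phi>) \<and> 0 \<in> ?B \<and> ?B \<subseteq> slit_domain \<phi> \<and>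
        slit_domain \<phi> \<noteq> UNIV \<and> conformal_iso f ?B (slit_domain \<phi>) \<and> f 0 = 0"
      using f open_slit_domain starlike_imp_simply_connected[OF starlike_slit_domain]
        slit_domain_neq_UNIV[OF ne] ball_subset_slit_domain convex_imp_simply_connected[OF convex_ball, of "0::complex" 1]
      by (simp add: slit_map_def)
  qed
  moreover have "emeasure (mu0 \<mu>) (slit_loops \<phi>) = emeasure (\<mu> plane) (slit_loops \<phi>)"
    by (intro emeasure_mu0[OF \<mu>]) (auto simp: mem_slit_loops)
  moreover have "cmod (deriv f 0) = rho0 (gammas \<phi>)"
    using rho0_gammas[OF assms f] slit_map_deriv[OF f] by (metis of_real_eq_iff)
  ultimately have eq: "enn2ereal (emeasure (\<mu> plane) (slit_loops \<phi>)) = ereal (ln (rho0 (gammas \<phi>)))"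
    by (simp add: slit_loops_def)
  then show "ln (rho0 (gammas \<phi>)) \<ge> 0"
    by (metis enn2ereal_nonneg ereal_less_eq(5) )
  then show "emeasure (\<mu> plane) (slit_loops \<phi>) = ennreal (ln (rho0 (gammas \<phi>)))"
    using eq by (metis e2ennreal_ereal e2ennreal_enn2ereal)
qed

lemma emeasure_UN_slit_loops:
  assumes n: "n \<ge> 1"
  shows "enn2ereal (emeasure (\<mu> plane) (\<Union>\<alpha>\<in>root_angle_set n. slit_loops [\<alpha>])) =
    ereal (\<Sum>m=1..n. (-1) ^ (m - 1) * (\<Sum>\<phi>\<in>root_angles n m. ln (rho0 (gammas \<phi>))))"
proof -
  let ?M = "\<mu> plane" and ?A = "root_angle_set n"
  \<comment> \<open>Real-valued \<open>measure\<close> is additive only on sets of finite measure;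
    for single slits Werner's formula supplies finiteness.\<close>
  interpret Incl_Excl "\<lambda>X. X \<in> fmeasurable ?M" "measure ?M"
    by unfold_locales (auto simp: disjnt_def measure_Un3 intro: fmeasurable_Int_fmeasurable fmeasurableD)
  have single: "slit_loops [\<alpha>] \<in> fmeasurable ?M" if "\<alpha> \<in> ?A" for \<alpha>
    using emeasure_slit_loops(1)[of "[\<alpha>]"] slit_loops_in_sets that
    by (intro fmeasurableI) (auto simp: slit_angles_def root_angle_set_def)
  have "measure ?M (\<Union>\<alpha>\<in>?A. slit_loops [\<alpha>]) =
      (\<Sum>S | S \<subseteq> ?A \<and> S \<noteq> {}. (-1) ^ (card S + 1) * measure ?M (\<Inter>\<alpha>\<in>S. slit_loops [\<alpha>]))"
    using single by (intro restricted_indexed finite_root_angle_set n)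
  also have "\<dots> = (\<Sum>m=1..n. (-1) ^ (m - 1) *
      (\<Sum>\<phi>\<in>root_angles n m. measure ?M (\<Inter>\<alpha>\<in>set \<phi>. slit_loops [\<alpha>])))"
    by (rule sum_subsets_eq_sum_root_angles[OF n])
  also have "\<dots> = (\<Sum>m=1..n. (-1) ^ (m - 1) * (\<Sum>\<phi>\<in>root_angles n m. ln (rho0 (gammas \<phi>))))"
  proof (intro sum.cong refl arg_cong2[where f = "(*)"])
    fix m \<phi> assume "\<phi> \<in> root_angles n m"
    then have "slit_angles \<phi>" by (simp add: root_angles_def)
    then show "measure ?M (\<Inter>\<alpha>\<in>set \<phi>. slit_loops [\<alpha>]) = ln (rho0 (gammas \<phi>))"
      using emeasure_slit_loops[of \<phi>] INT_slit_loops[of \<phi>]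
      by (simp add: measure_def slit_angles_def)
  qed
  finally have "measure ?M (\<Union>\<alpha>\<in>?A. slit_loops [\<alpha>]) =
      (\<Sum>m=1..n. (-1) ^ (m - 1) * (\<Sum>\<phi>\<in>root_angles n m. ln (rho0 (gammas \<phi>))))" .
  moreover have "(\<Union>\<alpha>\<in>?A. slit_loops [\<alpha>]) \<in> fmeasurable ?M"
    using single finite_root_angle_set[OF n] by (intro fmeasurable.finite_UN) auto
  then have "emeasure ?M (\<Union>\<alpha>\<in>?A. slit_loops [\<alpha>]) = ennreal (measure ?M (\<Union>\<alpha>\<in>?A. slit_loops [\<alpha>]))"
    by (rule emeasure_eq_measure2)
  ultimately show ?thesis by (metis enn2ereal_ennreal measure_nonneg)
qed

lemma mu0_UN_loops:
  assumes n: "n \<ge> 1"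
  shows "enn2ereal (emeasure (mu0 \<mu>)
        (\<Union>\<theta>\<in>{\<theta>::real. cis (real n * \<theta>) = 1}.
           loops1 (- {0} - {of_real t * cis \<theta> | t. 0 < t \<and> t \<le> 1})
             - loops (top_of_set {w. cmod w > 1})))
      = ereal (\<Sum>m=1..n. (-1) ^ (m - 1) * (\<Sum>\<phi>\<in>root_angles n m. ln (rho0 (gammas \<phi>))))"
    (is "enn2ereal (emeasure _ ?U) = _")
proof -
  interpret sigma_algebra "loops (top_of_set (- {0 :: complex}))" "borel_loops (- {0})"
    by (rule sigma_algebra_borel_loops)
  let ?W = "\<lambda>\<theta>. - {0} - {of_real t * cis \<theta> | t. 0 < t \<and> t \<le> 1}"
  have "open (?W \<theta>)" for \<theta>
    using closed_unit_slit[of \<theta>] by (metis (no_types, lifting) Compl_Un Diff_eq open_Compl)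
  then have "(\<Union>\<theta>\<in>{\<theta>. cis (real n * \<theta>) = 1}. loops1 (?W \<theta>)) \<in> borel_loops (- {0})"
    by (intro UN_loops1_in_borel_loops) auto
  moreover have "loops (top_of_set {w. cmod w > 1}) \<in> borel_loops (- {0})"
    by (intro loops_in_borel_loops) (auto intro!: open_Collect_less continuous_intros)
  ultimately have "(\<Union>\<theta>\<in>{\<theta>. cis (real n * \<theta>) = 1}. loops1 (?W \<theta>)) - loops (top_of_set {w. cmod w > 1}) \<in> borel_loops (- {0})"
    by blast
  also have "(\<Union>\<theta>\<in>{\<theta>. cis (real n * \<theta>) = 1}. loops1 (?W \<theta>)) - loops (top_of_set {w. cmod w > 1}) = ?U"
    by blast
  finally have U: "?U \<in> borel_loops (- {0})" .
  have "emeasure (mu0 \<mu>) ?U = emeasure (\<mu> plane) ?U"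
    by (intro emeasure_mu0[OF \<mu>]) (auto simp: mem_loops1_iff)
  also have "\<dots> = emeasure (\<mu> plane) (\<Union>\<alpha>\<in>root_angle_set n. slit_loops [\<alpha>])"
    using emeasure_plane_inverse_image[OF \<mu> U] unfolding inverse_image_UN_loops[OF n] by simp
  finally show ?thesis using emeasure_UN_slit_loops[OF n] by simp
qed

end

section \<open>Gaps and first angle as coordinates\<close>

lemma cis_eq_1_pos:
  assumes "cis x = 1" "x > 0"
  shows "\<exists>k::nat. k \<ge> 1 \<and> x = 2 * pi * k"
proof -
  have "sin x = sin 0 \<and> cos x = cos 0" using assms(1) by (simp add: complex_eq_iff)
  then obtain i :: int where i: "x = 2 * pi * i" using sin_cos_eq_iff[of x 0] by auto
  then have "i > 0" using assms(2) by (simp add: zero_less_mult_iff)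
  then show ?thesis using i by (intro exI[of _ "nat i"]) auto
qed

text \<open>Inverse of the map taking \<open>\<phi>\<close> to
  \<open>(gammas \<phi>, \<phi> ! 0)\<close>.\<close>

definition angles_of :: "real list \<Rightarrow> real \<Rightarrow> real list" where
  "angles_of \<gamma> \<alpha> = map (\<lambda>k. \<alpha> + pi * (\<Sum>j<k. \<gamma> ! j)) [0..<length \<gamma>]"

context
  fixes n m :: nat
  assumes n: "n \<ge> 1" and m: "m \<ge> 1"
begin

lemma gammas_root_angles:
  assumes "\<phi> \<in> root_angles n m"
  shows "gammas \<phi> \<in> root_gammas n m"
    and "\<phi> ! 0 \<in> {\<alpha>. 0 \<le> \<alpha> \<and> \<alpha> < pi * last (gammas \<phi>) \<and> cis (real n * \<alpha>) = 1}"
    and "angles_of (gammas \<phi>) (\<phi> ! 0) = \<phi>"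
proof -
  have \<phi>: "length \<phi> = m" "slit_angles \<phi>" "\<phi> \<noteq> []"
    and root: "\<And>j. j < m \<Longrightarrow> cis (real n * \<phi> ! j) = 1" "\<And>j. j < m \<Longrightarrow> 0 \<le> \<phi> ! j \<and> \<phi> ! j < 2 * pi"
    using assms by (auto simp: root_angles_def slit_angles_def subset_iff)
  have "\<exists>k::nat. k \<ge> 1 \<and> gammas \<phi> ! j = real k * (2 / real n)" if j: "j < m" for j
  proof -
    have root': "cis (real n * (\<phi> ! 0 + 2 * pi)) = 1"
    proof -
      have "cis (real n * (\<phi> ! 0 + 2 * pi)) = cis (real n * \<phi> ! 0) * cis (2 * pi * real n)"
        by (simp add: cis_mult algebra_simps)
      then show ?thesis using root(1)[of 0] m by simp
    qed
    define y where "y = (if Suc j < m then \<phi> ! Suc j else \<phi> ! 0 + 2 * pi)"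
    have y: "gammas \<phi> ! j = (y - \<phi> ! j) / pi" using gammas_nth[of j \<phi>] j \<phi>(1) by (simp add: y_def)
    have "cis (real n * y) = 1" unfolding y_def using root(1)[of "Suc j"] root' by simp
    moreover have "pi * gammas \<phi> ! j = y - \<phi> ! j" by (simp add: y)
    then have "real n * (pi * gammas \<phi> ! j) = real n * y - real n * \<phi> ! j"
      by (simp only: right_diff_distrib)
    ultimately have "cis (real n * (pi * gammas \<phi> ! j)) = 1"
      using root(1)[OF j] by (simp add: cis_divide[symmetric])
    moreover have pos: "gammas \<phi> ! j > 0" using gammas_pos[OF \<phi>(2)] j \<phi>(1) by simp
    ultimately obtain k :: nat where "k \<ge> 1" "real n * (pi * gammas \<phi> ! j) = 2 * pi * k"
      using cis_eq_1_pos[of "real n * (pi * gammas \<phi> ! j)"] n by auto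
    then show ?thesis using n by (intro exI[of _ k]) (auto simp: field_simps)
  qed
  then have "\<forall>g\<in>set (gammas \<phi>). \<exists>k::nat. k \<ge> 1 \<and> g = real k * (2 / real n)"
    using \<phi>(1) by (metis in_set_conv_nth length_gammas)
  moreover have "sum_list (gammas \<phi>) = 2"
    using sum_gammas[OF \<phi>(3)] by (simp add: sum_list_sum_nth atLeast0LessThan)
  ultimately show "gammas \<phi> \<in> root_gammas n m" using \<phi>(1) by (simp add: root_gammas_def)
  \<comment> \<open>The last gap reaches from the last angle to the first one after a full turn, so
    \<open>\<phi> ! (m - 1) < 2 * pi\<close> becomes the bound on \<open>\<phi> ! 0\<close>.\<close>
  have "last (gammas \<phi>) = gammas \<phi> ! (m - 1)"
    using \<phi> by (subst last_conv_nth) (auto simp: gammas_def)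
  also have "\<dots> = (\<phi> ! 0 + 2 * pi - \<phi> ! (m - 1)) / pi"
    using gammas_nth[of "m - 1" \<phi>] m \<phi>(1) by simp
  finally have "pi * last (gammas \<phi>) = \<phi> ! 0 + 2 * pi - \<phi> ! (m - 1)" by simp
  then show "\<phi> ! 0 \<in> {\<alpha>. 0 \<le> \<alpha> \<and> \<alpha> < pi * last (gammas \<phi>) \<and> cis (real n * \<alpha>) = 1}"
    using root(1)[of 0] root(2)[of 0] root(2)[of "m - 1"] m by simp
  show "angles_of (gammas \<phi>) (\<phi> ! 0) = \<phi>"
    by (rule nth_equalityI) (auto simp: angles_of_def gammas_partial_sum)
qed

lemma angles_of_root_gammas:
  assumes \<gamma>: "\<gamma> \<in> root_gammas n m"
    and \<alpha>: "\<alpha> \<in> {\<alpha>. 0 \<le> \<alpha> \<and> \<alpha> < pi * last \<gamma> \<and> cis (real n * \<alpha>) = 1}"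
  shows "angles_of \<gamma> \<alpha> \<in> root_angles n m" "gammas (angles_of \<gamma> \<alpha>) = \<gamma>" "angles_of \<gamma> \<alpha> ! 0 = \<alpha>"
proof -
  define S where "S = (\<lambda>k. \<Sum>j<k. \<gamma> ! j)"
  have len: "length \<gamma> = m" "\<gamma> \<noteq> []" using \<gamma> m by (auto simp: root_gammas_def)
  have g: "\<exists>k::nat. k \<ge> 1 \<and> \<gamma> ! j = real k * (2 / real n)" if "j < m" for j
    using \<gamma> that len by (auto simp: root_gammas_def)
  have pos: "\<gamma> ! j > 0" if "j < m" for j using g[OF that] n by auto
  have nth: "angles_of \<gamma> \<alpha> ! k = \<alpha> + pi * S k" if "k < m" for k
    using that len by (simp add: angles_of_def S_def)
  have len': "length (angles_of \<gamma> \<alpha>) = m" using len by (simp add: angles_of_def)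
  have Sm: "S m = 2" using \<gamma> len by (simp add: S_def root_gammas_def sum_list_sum_nth atLeast0LessThan)
  have S_less: "S i < S k" if "i < k" "k \<le> m" for i k
  proof -
    have "S k = S i + (\<Sum>j\<in>{i..<k}. \<gamma> ! j)"
      unfolding S_def using that by (metis lessThan_atLeast0 sum.atLeastLessThan_concat zero_le less_imp_le)
    moreover have "(\<Sum>j\<in>{i..<k}. \<gamma> ! j) > 0" using that pos by (intro sum_pos) auto
    ultimately show ?thesis by simp
  qed
  \<comment> \<open>The last angle is \<open>\<alpha> + pi * (2 - last \<gamma>)\<close>, so the
    bound on \<open>\<alpha>\<close> says exactly that it stays below \<open>2 * pi\<close>.\<close>
  have S_last: "S (m - 1) = 2 - last \<gamma>"
  proof -
    have "S m = S (m - 1) + \<gamma> ! (m - 1)" using m by (cases m) (auto simp: S_def)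
    then show ?thesis using Sm len by (simp add: last_conv_nth)
  qed
  have "sorted_wrt (<) (angles_of \<gamma> \<alpha>)"
    unfolding sorted_wrt_iff_nth_less using S_less nth len' by simp
  moreover have "0 \<le> angles_of \<gamma> \<alpha> ! k \<and> angles_of \<gamma> \<alpha> ! k < 2 * pi" if "k < m" for k
  proof -
    have "0 \<le> S k" using S_less[of 0 k] that by (cases k) (auto simp: S_def)
    moreover have "k = m - 1 \<or> k < m - 1" using that by linarith
    then have "S k \<le> 2 - last \<gamma>"
      using S_less[of k "m - 1"] unfolding S_last[symmetric] by auto
    then have "pi * S k \<le> pi * (2 - last \<gamma>)" by (intro mult_left_mono) auto
    ultimately show ?thesis using \<alpha> nth[OF that] by (simp add: algebra_simps)
  qed
  moreover have "cis (real n * angles_of \<gamma> \<alpha> ! k) = 1" if "k < m" for k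
  proof -
    have "cis (real n * (\<alpha> + pi * S k)) = 1" if "k \<le> m" for k
      using that
    proof (induction k)
      case 0
      then show ?case using \<alpha> by (simp add: S_def)
    next
      case (Suc k)
      obtain l :: nat where "\<gamma> ! k = real l * (2 / real n)" using g[of k] Suc.prems by auto
      then have "real n * (pi * \<gamma> ! k) = 2 * pi * real l" using n by simp
      then have "cis (real n * (pi * \<gamma> ! k)) = cis (2 * pi * real l)" by (rule arg_cong)
      also have "\<dots> = 1" by simp
      finally have "cis (real n * (pi * \<gamma> ! k)) = 1" .
      moreover have "cis (real n * (\<alpha> + pi * S (Suc k))) = cis (real n * (\<alpha> + pi * S k)) * cis (real n * (pi * \<gamma> ! k))"
        by (simp add: S_def cis_mult algebra_simps)
      ultimately show ?case using Suc by simp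
    qed
    then show ?thesis using nth that by simp
  qed
  moreover have "angles_of \<gamma> \<alpha> \<noteq> []" using len' m by auto
  ultimately show "angles_of \<gamma> \<alpha> \<in> root_angles n m"
    using len' by (auto simp: root_angles_def slit_angles_def in_set_conv_nth)
  show "angles_of \<gamma> \<alpha> ! 0 = \<alpha>" using nth[of 0] m by (simp add: S_def)
  show "gammas (angles_of \<gamma> \<alpha>) = \<gamma>"
  proof (rule nth_equalityI)
    fix j assume "j < length (gammas (angles_of \<gamma> \<alpha>))"
    then have j: "j < m" using len' by simp
    show "gammas (angles_of \<gamma> \<alpha>) ! j = \<gamma> ! j"
    proof (cases "Suc j < m")
      case True
      then show ?thesis using gammas_nth[of j "angles_of \<gamma> \<alpha>"] nth len' j by (simp add: S_def algebra_simps)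
    next
      case False
      then have jm: "j = m - 1" using j by simp
      have "gammas (angles_of \<gamma> \<alpha>) ! j = (\<alpha> + 2 * pi - (\<alpha> + pi * (2 - last \<gamma>))) / pi"
        using gammas_nth[of j "angles_of \<gamma> \<alpha>"] nth[of 0] nth[OF j] len' j False S_last
        by (simp add: jm S_def)
      then show ?thesis using len jm by (simp add: last_conv_nth algebra_simps)
    qed
  qed (simp add: len len')
qed

lemma sum_root_angles_eq_sum_root_gammas:
  fixes h :: "real list \<Rightarrow> real"
  shows "(\<Sum>\<phi>\<in>root_angles n m. h (gammas \<phi>)) =
    (\<Sum>\<gamma>\<in>root_gammas n m. real (card {\<alpha>. 0 \<le> \<alpha> \<and> \<alpha> < pi * last \<gamma> \<and> cis (real n * \<alpha>) = 1}) * h \<gamma>)"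
proof -
  let ?A = "\<lambda>\<gamma>. {\<alpha>. 0 \<le> \<alpha> \<and> \<alpha> < pi * last \<gamma> \<and> cis (real n * \<alpha>) = 1}"
  \<comment> \<open>Finiteness of the gap lists and of the sets of first angles is obtained by
    projecting the image of the finite set \<open>root_angles n m\<close>; for infinite sets
    \<open>sum\<close> and \<open>card\<close> would default to 0.\<close>
  have "Sigma (root_gammas n m) ?A \<subseteq> (\<lambda>\<phi>. (gammas \<phi>, \<phi> ! 0)) ` root_angles n m"
  proof
    fix x assume "x \<in> Sigma (root_gammas n m) ?A"
    then obtain \<gamma> \<alpha> where x: "x = (\<gamma>, \<alpha>)" "\<gamma> \<in> root_gammas n m" "\<alpha> \<in> ?A \<gamma>" by (rule SigmaE)
    note a = angles_of_root_gammas[OF x(2,3)]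
    show "x \<in> (\<lambda>\<phi>. (gammas \<phi>, \<phi> ! 0)) ` root_angles n m"
      by (rule image_eqI[OF _ a(1)]) (simp add: x(1) a)
  qed
  then have fin: "finite (Sigma (root_gammas n m) ?A)"
    using finite_root_angles[OF n] by (meson finite_imageI finite_subset)
  \<comment> \<open>With 0 as an admissible first angle, every gap list occurs in the
    projection.\<close>
  have ne: "0 \<in> ?A \<gamma>" if "\<gamma> \<in> root_gammas n m" for \<gamma>
  proof -
    have "\<gamma> \<noteq> []" using that m by (auto simp: root_gammas_def)
    then have "last \<gamma> > 0" using that n by (fastforce simp: root_gammas_def dest: last_in_set)
    then show ?thesis by simp
  qed
  have "root_gammas n m \<subseteq> fst ` Sigma (root_gammas n m) ?A"
    using ne by (force simp: image_iff)
  then have fin1: "finite (root_gammas n m)" using fin by (meson finite_imageI finite_subset)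
  have fin2: "finite (?A \<gamma>)" if "\<gamma> \<in> root_gammas n m" for \<gamma>
  proof (rule finite_subset)
    show "?A \<gamma> \<subseteq> snd ` Sigma (root_gammas n m) ?A" using that by (force simp: image_iff)
  qed (use fin in simp)
  have "(\<Sum>\<phi>\<in>root_angles n m. h (gammas \<phi>)) = (\<Sum>(\<gamma>, \<alpha>)\<in>Sigma (root_gammas n m) ?A. h \<gamma>)"
  proof (rule sum.reindex_bij_witness[of _ "\<lambda>(\<gamma>, \<alpha>). angles_of \<gamma> \<alpha>" "\<lambda>\<phi>. (gammas \<phi>, \<phi> ! 0)"])
    fix \<phi> assume "\<phi> \<in> root_angles n m"
    note g = gammas_root_angles[OF this]
    show "(gammas \<phi>, \<phi> ! 0) \<in> Sigma (root_gammas n m) ?A" using g(1,2) by (rule SigmaI)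
    show "(case (gammas \<phi>, \<phi> ! 0) of (\<gamma>, \<alpha>) \<Rightarrow> angles_of \<gamma> \<alpha>) = \<phi>" using g(3) by simp
    show "(case (gammas \<phi>, \<phi> ! 0) of (\<gamma>, \<alpha>) \<Rightarrow> h \<gamma>) = h (gammas \<phi>)" by simp
  next
    fix x assume "x \<in> Sigma (root_gammas n m) ?A"
    then obtain \<gamma> \<alpha> where x: "x = (\<gamma>, \<alpha>)" "\<gamma> \<in> root_gammas n m" "\<alpha> \<in> ?A \<gamma>" by (rule SigmaE)
    note a = angles_of_root_gammas[OF x(2,3)]
    show "(case x of (\<gamma>, \<alpha>) \<Rightarrow> angles_of \<gamma> \<alpha>) \<in> root_angles n m" using a(1) by (simp add: x(1))
    show "(gammas (case x of (\<gamma>, \<alpha>) \<Rightarrow> angles_of \<gamma> \<alpha>), (case x of (\<gamma>, \<alpha>) \<Rightarrow> angles_of \<gamma> \<alpha>) ! 0) = x"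
      by (simp add: x(1) a)
  qed
  also have "\<dots> = (\<Sum>\<gamma>\<in>root_gammas n m. \<Sum>\<alpha>\<in>?A \<gamma>. h \<gamma>)"
    using fin1 fin2 by (subst sum.Sigma) auto
  finally show ?thesis by simp
qed

end

theorem theorem3p2:
  fixes n :: nat and \<mu> :: loop_measure_family
  assumes "n \<ge> 1" and "werner_family \<mu>"
  shows
    "(enn2ereal (emeasure (mu0 \<mu>)
        (\<Union>\<theta>\<in>{\<theta>::real. cis (real n * \<theta>) = 1}.
           loops1 (- {0} - {of_real t * cis \<theta> | t. 0 < t \<and> t \<le> 1})
             - loops (top_of_set {w. cmod w > 1})))
      = ereal (\<Sum>m=1..n. (-1) ^ (m - 1) * (\<Sum>\<phi>\<in>root_angles n m. ln (rho0 (gammas \<phi>))))) \<and>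
    (\<forall>\<phi> f z c. slit_data \<phi> f z c \<longrightarrow>
       (let m = length \<phi>; \<gamma> = gammas \<phi> in
         (\<forall>i<m. rho0 \<gamma> = (\<Prod>j<m. cmod (z ! j - c ! i) powr (\<gamma> ! j))) \<and>
         rho0 \<gamma> = (\<Prod>j<m. slit_coeff \<gamma> j powr (\<gamma> ! j)) powr (1 / real m) \<and>
         (\<forall>j<m. slit_coeff \<gamma> j = (\<Prod>i<m. cmod (1 - c ! i / z ! j))) \<and>
         (m = 2 \<longrightarrow> slit_coeff \<gamma> 0 = 2 * \<gamma> ! 0) \<and>
         ((\<forall>j<m. \<gamma> ! j = 2 / real m) \<longrightarrow> (\<forall>j<m. slit_coeff \<gamma> j = 2)))) \<and>
    ((\<Sum>m=1..n. (-1) ^ (m - 1) * (\<Sum>\<phi>\<in>root_angles n m. ln (rho0 (gammas \<phi>))))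
      = (\<Sum>m=1..n. (-1) ^ (m - 1) * (\<Sum>\<gamma>\<in>root_gammas n m.
           real (card {\<alpha>::real. 0 \<le> \<alpha> \<and> \<alpha> < pi * last \<gamma> \<and> cis (real n * \<alpha>) = 1}) *
             ln (rho0 \<gamma>))))"
proof (intro conjI)
  show "enn2ereal (emeasure (mu0 \<mu>)
        (\<Union>\<theta>\<in>{\<theta>::real. cis (real n * \<theta>) = 1}.
           loops1 (- {0} - {of_real t * cis \<theta> | t. 0 < t \<and> t \<le> 1})
             - loops (top_of_set {w. cmod w > 1})))
      = ereal (\<Sum>m=1..n. (-1) ^ (m - 1) * (\<Sum>\<phi>\<in>root_angles n m. ln (rho0 (gammas \<phi>))))"
    by (rule mu0_UN_loops[OF assms(2,1)])
next
  show "\<forall>\<phi> f z c. slit_data \<phi> f z c \<longrightarrow>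
       (let m = length \<phi>; \<gamma> = gammas \<phi> in
         (\<forall>i<m. rho0 \<gamma> = (\<Prod>j<m. cmod (z ! j - c ! i) powr (\<gamma> ! j))) \<and>
         rho0 \<gamma> = (\<Prod>j<m. slit_coeff \<gamma> j powr (\<gamma> ! j)) powr (1 / real m) \<and>
         (\<forall>j<m. slit_coeff \<gamma> j = (\<Prod>i<m. cmod (1 - c ! i / z ! j))) \<and>
         (m = 2 \<longrightarrow> slit_coeff \<gamma> 0 = 2 * \<gamma> ! 0) \<and>
         ((\<forall>j<m. \<gamma> ! j = 2 / real m) \<longrightarrow> (\<forall>j<m. slit_coeff \<gamma> j = 2)))"
    unfolding Let_def
  proof (intro allI impI conjI)
    fix \<phi> f z c assume D: "slit_data \<phi> f z c"
    show "rho0 (gammas \<phi>) = (\<Prod>j<length \<phi>. cmod (z ! j - c ! i) powr (gammas \<phi> ! j))" if "i < length \<phi>" for i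
      by (rule rho0_eq_prod_dist[OF D that])
    show coeff: "slit_coeff (gammas \<phi>) j = (\<Prod>i<length \<phi>. cmod (1 - c ! i / z ! j))" if "j < length \<phi>" for j
      by (rule slit_coeff_eq[OF D that])
    have "(\<Prod>j<length \<phi>. slit_coeff (gammas \<phi>) j powr (gammas \<phi> ! j)) = rho0 (gammas \<phi>) powr real (length \<phi>)"
      using rho0_power_length[OF D] slit_data_rho0(2)[OF D] by (simp add: coeff powr_realpow)
    then show "rho0 (gammas \<phi>) = (\<Prod>j<length \<phi>. slit_coeff (gammas \<phi>) j powr (gammas \<phi> ! j)) powr (1 / real (length \<phi>))"
      using slit_data_rho0(2)[OF D] slit_data_length(3)[OF D] by (simp add: powr_powr)
    show "slit_coeff (gammas \<phi>) 0 = 2 * gammas \<phi> ! 0" if "length \<phi> = 2"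
      using prod_tips_two_slits[OF D that] coeff[of 0] that by simp
    show "slit_coeff (gammas \<phi>) j = 2" if "\<forall>j<length \<phi>. gammas \<phi> ! j = 2 / real (length \<phi>)" "j < length \<phi>" for j
      using prod_tips_equal_gaps[OF D] that coeff[OF that(2)] by simp
  qed
next
  show "(\<Sum>m=1..n. (-1) ^ (m - 1) * (\<Sum>\<phi>\<in>root_angles n m. ln (rho0 (gammas \<phi>))))
      = (\<Sum>m=1..n. (-1) ^ (m - 1) * (\<Sum>\<gamma>\<in>root_gammas n m.
           real (card {\<alpha>::real. 0 \<le> \<alpha> \<and> \<alpha> < pi * last \<gamma> \<and> cis (real n * \<alpha>) = 1}) *
             ln (rho0 \<gamma>)))"
    by (intro sum.cong refl arg_cong2[where f = "(*)"] sum_root_angles_eq_sum_root_gammas[OF assms(1)]) auto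
qed

end
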